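(* Let $n\ge1$ and let $m$ be a positive integer or half-integer. Let $\eta,\lambda$ be vectors, both of integers or both of half-integers, in $\mathcal A^{\tilde B_n}_m=\{(x_1,\dots,x_n): x_1>\dots>x_n>0,\ x_1+x_2<2m\}$. Then, as $k\to\infty$ with $k\equiv2\eta_j+2\lambda_j\pmod2$, the number of walks from $\eta$ to $\lambda$ with exactly $k$ diagonal steps staying in $\mathcal A^{\tilde B_n}_m$ is asymptotically $$\frac{4^{n^2}}{2(2m)^n}\left(2^n\prod_{j=1}^n\cos\frac{(2j-1)\pi}{4m}\right)^k\prod_{1\le h<t\le n}\left(\sin\frac{\pi(\eta_h-\eta_t)}{2m}\sin\frac{\pi(\lambda_h-\lambda_t)}{2m}\sin\frac{\pi(\eta_h+\eta_t)}{2m}\sin\frac{\pi(\lambda_h+\lambda_t)}{2m}\right)\prod_{h=1}^n\left(\sin\frac{\pi\eta_h}{2m}\sin\frac{\pi\lambda_h}{2m}\right).$$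
   Context: A half-integer is an odd integer divided by $2$. A walk with $k$ diagonal steps from $\eta$ to $\lambda$ is a sequence $p_0=\eta,\dots,p_k=\lambda$ with $p_i-p_{i-1}\in\{(\pm\frac12,\dots,\pm\frac12)\}$ (all sign patterns); it stays in $R$ if all $p_i\in R$. "Asymptotically $E$" means the ratio of the count to $E$ tends to $1$. *)

theory Defs
  imports "HOL-Analysis.Analysis" "HOL-Library.Landau_Symbols" "HOL-Library.Real_Mod"
begin

definition half_integer :: "real \<Rightarrow> bool" where
  "half_integer x \<longleftrightarrow> (\<exists>a::int. odd a \<and> x = of_int a / 2)"

text \<open>
  A vector of dimension \<open>n\<close> is an extensional function on \<open>{1..n}\<close>, so that vectors of
  \<open>\<real>\<^sup>n\<close> correspond bijectively to the elements of \<open>{1..n} \<rightarrow>\<^sub>E UNIV\<close>.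

  For \<open>n = 1\<close> there is no coordinate \<open>x\<^sub>2\<close>; the bound \<open>x\<^sub>1 + x\<^sub>2 < 2 m\<close> is then read with
  \<open>x\<^sub>2 = 0\<close>, so the alcove is the interval \<open>0 < x\<^sub>1 < 2 m\<close>.  Without an upper bound, or with
  \<open>x\<^sub>1 < m\<close> instead, the stated growth rate \<open>2 cos (\<pi> / (4 m))\<close> would be wrong.
\<close>

definition alcove_B :: "nat \<Rightarrow> real \<Rightarrow> (nat \<Rightarrow> real) set" where
  "alcove_B n m = {x \<in> {1..n} \<rightarrow>\<^sub>E UNIV.
     (\<forall>i j. 1 \<le> i \<and> i < j \<and> j \<le> n \<longrightarrow> x i > x j) \<and>
     x n > 0 \<and>
     x 1 + (if n \<ge> 2 then x 2 else 0) < 2 * m}"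

text \<open>
  Walks are extensional as well (on the time set \<open>{0..k}\<close>), so that counting functions
  counts sequences \<open>p\<^sub>0, \<dots>, p\<^sub>k\<close>.
\<close>

definition diagonal_walks ::
  "nat \<Rightarrow> (nat \<Rightarrow> real) set \<Rightarrow> (nat \<Rightarrow> real) \<Rightarrow> (nat \<Rightarrow> real) \<Rightarrow> nat \<Rightarrow> (nat \<Rightarrow> nat \<Rightarrow> real) set"
where
  "diagonal_walks n R \<eta> \<mu> k = {p \<in> {0..k} \<rightarrow>\<^sub>E R.
     p 0 = \<eta> \<and> p k = \<mu> \<and>
     (\<forall>i\<in>{1..k}. \<forall>j\<in>{1..n}. p i j - p (i - 1) j \<in> {1/2, -1/2})}"

end

theory Submission
  imports Defs "Jordan_Normal_Form.Determinant"
begin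

text \<open>
  Write \<open>N = 2 m\<close>. The functions \<open>x \<mapsto> sin (\<pi> b x / N)\<close> are eigenfunctions of the one-dimensional
  walk with steps \<open>\<plusminus>1/2\<close>, vanish at \<open>0\<close>, and are symmetric (\<open>b\<close> odd) or antisymmetric (\<open>b\<close> even)
  under \<open>x \<mapsto> N - x\<close>. Hence for either parity of \<open>b\<close> the determinant of the one-dimensional kernels
  satisfies the recursion of the walks and vanishes on every wall \<open>x\<^sub>i = x\<^sub>j\<close>, \<open>x\<^sub>n = 0\<close>,
  \<open>x\<^sub>1 + x\<^sub>2 = N\<close>; the mean of the two determinants also has the right initial value, so it counts
  the walks. Expanding it into eigenfunctions, only tuples of distinct frequencies survive, and at
  even times frequencies may be folded into \<open>0 < b < N\<close>. The rearrangements of \<open>1, 3, \<dots>, 2 n - 1\<close>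
  then dominate strictly, and they recombine to a product of two determinants
  \<open>det (sin ((2 i - 1) \<pi> x\<^sub>j / N))\<close>, which are Vandermonde determinants in \<open>sin\<^sup>2\<close>.

  The alcove only contains lattice points if \<open>2 n \<le> N + 1\<close>; in the extreme case \<open>2 n = N + 1\<close> the
  largest eigenvalue is \<open>0\<close> and both sides vanish.
\<close>

section \<open>Determinants\<close>

text \<open>Entries are a plain function rather than a matrix, so they can be rewritten without
  carrier conditions; indices run over \<open>{..<n}\<close>.\<close>

definition fdet :: "nat \<Rightarrow> (nat \<Rightarrow> nat \<Rightarrow> real) \<Rightarrow> real" where
  "fdet n F = Determinant.det (Matrix.mat n n (\<lambda>(i, j). F i j))"

lemma fdet_expand:
  "fdet n F = (\<Sum>p | p permutes {..<n}. of_int (sign p) * (\<Prod>i<n. F i (p i)))"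
proof -
  have "fdet n F = (\<Sum>p | p permutes {0..<n}. of_int (sign p) *
      (\<Prod>i = 0..<n. Matrix.mat n n (\<lambda>(i, j). F i j) $$ (i, p i)))"
    unfolding fdet_def by (rule det_def'[of _ n]) simp
  also have "\<dots> = (\<Sum>p | p permutes {0..<n}. of_int (sign p) * (\<Prod>i = 0..<n. F i (p i)))"
    by (intro sum.cong refl arg_cong2[of _ _ _ _ "(*)"] prod.cong)
      (auto dest: permutes_in_image)
  finally show ?thesis by (simp add: atLeast0LessThan)
qed

lemma fdet_cong:
  assumes "\<And>i j. i < n \<Longrightarrow> j < n \<Longrightarrow> F i j = G i j"
  shows "fdet n F = fdet n G"
  unfolding fdet_def by (rule arg_cong[of _ _ Determinant.det], rule eq_matI) (auto simp: assms)

lemma fdet_transpose: "fdet n (\<lambda>i j. F j i) = fdet n F"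
proof -
  have "Matrix.mat n n (\<lambda>(i, j). F j i) = transpose_mat (Matrix.mat n n (\<lambda>(i, j). F i j))"
    by (rule eq_matI) auto
  then show ?thesis
    unfolding fdet_def by (simp add: det_transpose[of _ n])
qed

text \<open>Factoring \<open>a\<close> out of row \<open>i\<close> leaves two equal rows. The
  reflecting wall uses the factor \<open>- ((-1) ^ s)\<close>; coinciding coordinates and repeated
  frequencies use \<open>a = 1\<close>.\<close>

lemma fdet_proportional_rows:
  assumes "i < n" "i' < n" "i \<noteq> i'" and "\<And>j. j < n \<Longrightarrow> F i j = a * F i' j"
  shows "fdet n F = 0"
proof -
  let ?A = "Matrix.mat n n (\<lambda>(k, j). if k = i then F i' j else F k j)"
  have "Matrix.mat n n (\<lambda>(i, j). F i j) = multrow i a ?A"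
    by (rule eq_matI) (use assms in auto)
  then have "fdet n F = a * Determinant.det ?A"
    unfolding fdet_def using assms by (simp add: det_multrow[of _ n])
  also have "Determinant.det ?A = 0"
    by (rule det_identical_rows[of _ n i i']) (use assms in auto)
  finally show ?thesis by simp
qed

lemma fdet_zero_row:
  assumes "i < n" and "\<And>j. j < n \<Longrightarrow> F i j = 0"
  shows "fdet n F = 0"
  unfolding fdet_expand
proof (rule sum.neutral, rule ballI)
  fix p assume "p \<in> {p. p permutes {..<n}}"
  then have "p i < n" using assms(1) by (auto dest: permutes_in_image)
  then have "(\<Prod>i<n. F i (p i)) = 0" using assms by (intro prod_zero) auto
  then show "of_int (sign p) * (\<Prod>i<n. F i (p i)) = 0" by simp
qed

lemma fdet_permute_rows:
  assumes "p permutes {..<n}"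
  shows "fdet n (\<lambda>i. F (p i)) = of_int (sign p) * fdet n F"
proof -
  have p: "p permutes {0..<n}" and "\<And>i. p i < n \<longleftrightarrow> i < n"
    using assms permutes_in_image[OF assms] by (simp_all add: atLeast0LessThan)
  then have "Matrix.mat n n (\<lambda>(i, j). F (p i) j)
      = Matrix.mat n n (\<lambda>(i, j). Matrix.mat n n (\<lambda>(i, j). F i j) $$ (p i, j))"
    by (intro eq_matI) simp_all
  then show ?thesis
    unfolding fdet_def using det_permute_rows[OF mat_carrier p, of "\<lambda>(i, j). F i j"] by simp
qed

lemma fdet_mult:
  "fdet n (\<lambda>i j. \<Sum>k<n. F i k * G k j) = fdet n F * fdet n G"
proof -
  have "Matrix.mat n n (\<lambda>(i, j). \<Sum>k<n. F i k * G k j)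
      = Matrix.mat n n (\<lambda>(i, j). F i j) * Matrix.mat n n (\<lambda>(i, j). G i j)"
    by (rule eq_matI) (auto simp: scalar_prod_def atLeast0LessThan)
  then show ?thesis
    unfolding fdet_def by (simp add: det_mult[of _ n])
qed

lemma fdet_upper_triangular:
  assumes "\<And>i j. j < i \<Longrightarrow> i < n \<Longrightarrow> F i j = 0"
  shows "fdet n F = (\<Prod>i<n. F i i)"
proof -
  have "fdet n F = prod_list (diag_mat (Matrix.mat n n (\<lambda>(i, j). F i j)))"
    unfolding fdet_def by (rule det_upper_triangular[of _ n]) (auto simp: assms)
  then show ?thesis
    by (simp add: prod_list_diag_prod atLeast0LessThan)
qed

lemma fdet_scale_columns: "fdet n (\<lambda>i j. c j * F i j) = (\<Prod>j<n. c j) * fdet n F"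
proof -
  have "fdet n (\<lambda>i j. c j * F i j)
      = (\<Sum>p | p permutes {..<n}. of_int (sign p) * ((\<Prod>i<n. c (p i)) * (\<Prod>i<n. F i (p i))))"
    by (simp add: fdet_expand prod.distrib)
  also have "\<dots> = (\<Sum>p | p permutes {..<n}. (\<Prod>j<n. c j) * (of_int (sign p) * (\<Prod>i<n. F i (p i))))"
    by (intro sum.cong refl) (simp add: prod.permute[symmetric, unfolded o_def])
  finally show ?thesis by (simp add: fdet_expand sum_distrib_left)
qed

text \<open>Multilinearity in all rows at once. The sets \<open>B i\<close> will be the two possible
  predecessors of a coordinate, and later the frequencies.\<close>

lemma fdet_row_sums:
  assumes "\<And>i. i < n \<Longrightarrow> finite (B i)"
  shows "fdet n (\<lambda>i j. \<Sum>b\<in>B i. c i b * G i b j)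
    = (\<Sum>b\<in>PiE {..<n} B. (\<Prod>i<n. c i (b i)) * fdet n (\<lambda>i. G i (b i)))"
proof -
  have "fdet n (\<lambda>i j. \<Sum>b\<in>B i. c i b * G i b j)
      = (\<Sum>p | p permutes {..<n}. of_int (sign p) *
          (\<Sum>b\<in>PiE {..<n} B. \<Prod>i<n. c i (b i) * G i (b i) (p i)))"
    unfolding fdet_expand
    by (intro sum.cong refl arg_cong2[of _ _ _ _ "(*)"] prod_sum_PiE) (auto simp: assms)
  also have "\<dots> = (\<Sum>b\<in>PiE {..<n} B. \<Sum>p | p permutes {..<n}.
      of_int (sign p) * (\<Prod>i<n. c i (b i) * G i (b i) (p i)))"
    unfolding sum_distrib_left by (rule sum.swap)
  also have "\<dots> = (\<Sum>b\<in>PiE {..<n} B. (\<Prod>i<n. c i (b i)) * fdet n (\<lambda>i. G i (b i)))"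
    unfolding fdet_expand sum_distrib_left prod.distrib
    by (intro sum.cong refl) (simp add: mult_ac)
  finally show ?thesis .
qed

text \<open>Since \<open>f\<close> and \<open>g\<close> decrease strictly, the identity is the only permutation whose product
  can be nonzero.\<close>

lemma fdet_eq_diagonal_prod:
  fixes f g :: "nat \<Rightarrow> real"
  assumes f: "\<And>i j. i < j \<Longrightarrow> j < n \<Longrightarrow> f j < f i"
    and g: "\<And>i j. i < j \<Longrightarrow> j < n \<Longrightarrow> g j < g i"
    and F: "\<And>i j. i < n \<Longrightarrow> j < n \<Longrightarrow> F i j \<noteq> 0 \<Longrightarrow> f i = g j"
  shows "fdet n F = (\<Prod>i<n. F i i)"
proof -
  have zero: "(\<Prod>i<n. F i (p i)) = 0" if p: "p permutes {..<n}" "p \<noteq> id" for p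
  proof (rule ccontr)
    assume nz: "(\<Prod>i<n. F i (p i)) \<noteq> 0"
    have pn: "p i < n" if "i < n" for i using p(1) that by (auto dest: permutes_in_image)
    have fg: "f i = g (p i)" if "i < n" for i
      using nz pn that by (intro F) (auto simp: prod_zero_iff)
    have mono: "p i < p j" if "i < j" "j < n" for i j
    proof (rule ccontr)
      assume "\<not> p i < p j"
      then have "g (p i) \<le> g (p j)"
        using g[of "p j" "p i"] pn[of i] that by (cases "p i = p j") (auto simp: not_less)
      then show False using fg[of i] fg[of j] f[of i j] that by simp
    qed
    \<comment> \<open>A strictly increasing map on \<open>{..<n}\<close> never falls below the
      diagonal, and a permutation with this property is the identity.\<close>
    have "i \<le> p i" if "i < n" for i
      using that
    proof (induction i)
      case (Suc i)
      then have "i \<le> p i" and "p i < p (Suc i)" by (auto intro: mono)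
      then show ?case by linarith
    qed simp
    then have "p = id" using permutes_natset_ge[OF p(1)] by simp
    then show False using p by simp
  qed
  have "fdet n F = (\<Sum>p\<in>{id}. of_int (sign p) * (\<Prod>i<n. F i (p i)))"
    unfolding fdet_expand
  proof (rule sum.mono_neutral_right)
    show "\<forall>p\<in>{p. p permutes {..<n}} - {id}. of_int (sign p) * (\<Prod>i<n. F i (p i)) = 0"
    proof
      fix p assume "p \<in> {p. p permutes {..<n}} - {id}"
      then have "(\<Prod>i<n. F i (p i)) = 0" by (intro zero) auto
      then show "of_int (sign p) * (\<Prod>i<n. F i (p i)) = 0" by simp
    qed
  qed (auto simp: permutes_id finite_permutations)
  then show ?thesis by (simp add: sign_id)
qed

section \<open>Determinants of polynomials and of odd sines\<close>

text \<open>The matrix is the coefficient matrix times the matrix of powers; the degree bound makes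
  the coefficient matrix triangular.\<close>

lemma fdet_poly:
  fixes q :: "nat \<Rightarrow> real poly"
  assumes "\<And>i. degree (q i) \<le> i"
  shows "fdet n (\<lambda>i j. poly (q i) (t j)) = (\<Prod>i<n. coeff (q i) i) * fdet n (\<lambda>i j. t j ^ i)"
proof -
  have "fdet n (\<lambda>i j. poly (q i) (t j)) = fdet n (\<lambda>i j. \<Sum>k<n. coeff (q i) k * t j ^ k)"
  proof (rule fdet_cong)
    fix i j assume "i < n" "j < n"
    have "poly (q i) (t j) = (\<Sum>k\<le>degree (q i). coeff (q i) k * t j ^ k)"
      by (rule poly_altdef)
    also have "\<dots> = (\<Sum>k<n. coeff (q i) k * t j ^ k)"
      using assms[of i] \<open>i < n\<close>
      by (intro sum.mono_neutral_left) (auto simp: coeff_eq_0)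
    finally show "poly (q i) (t j) = (\<Sum>k<n. coeff (q i) k * t j ^ k)" .
  qed
  also have "\<dots> = fdet n (\<lambda>i k. coeff (q i) k) * fdet n (\<lambda>i j. t j ^ i)"
    by (rule fdet_mult)
  also have "fdet n (\<lambda>i k. coeff (q i) k) = fdet n (\<lambda>k i. coeff (q i) k)"
    by (rule fdet_transpose)
  also have "\<dots> = (\<Prod>i<n. coeff (q i) i)"
  proof (rule fdet_upper_triangular)
    fix i j :: nat assume "j < i" "i < n"
    then show "coeff (q j) i = 0" using assms[of j] by (intro coeff_eq_0) auto
  qed
  finally show ?thesis .
qed

text \<open>Replacing the monomials by the monic Newton polynomials \<open>q i\<close> keeps the
  determinant. Since \<open>q i\<close> vanishes at \<open>t j\<close> for \<open>j < i\<close>, the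
  new matrix is triangular.\<close>

lemma fdet_vandermonde: "fdet n (\<lambda>i j. t j ^ i) = (\<Prod>i<n. \<Prod>l<i. t i - t l)"
proof -
  define q where "q i = (\<Prod>l<i. [:- t l, 1:])" for i
  have monic: "lead_coeff (q i) = 1" for i
    unfolding q_def by (simp add: lead_coeff_prod)
  have deg: "degree (q i) = i" for i
    unfolding q_def by (subst degree_prod_sum_eq) auto
  have "fdet n (\<lambda>i j. poly (q i) (t j)) = fdet n (\<lambda>i j. t j ^ i)"
    using fdet_poly[of q n t] monic by (simp add: deg)
  moreover have "fdet n (\<lambda>i j. poly (q i) (t j)) = (\<Prod>i<n. poly (q i) (t i))"
    by (rule fdet_upper_triangular) (auto simp: q_def poly_prod)
  ultimately show ?thesis by (simp add: q_def poly_prod)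
qed

section \<open>Sines of odd multiples of an angle\<close>

text \<open>This is the Chebyshev quotient sin((2i+1)x) / sin x as a polynomial in t = sin^2 x. The
  recursion is sin(a+2x) + sin(a-2x) = 2 cos(2x) sin a with 2 cos(2x) = 2 - 4t.\<close>

fun sin_poly :: "nat \<Rightarrow> real poly" where
  "sin_poly 0 = 1"
| "sin_poly (Suc 0) = [:3, -4:]"
| "sin_poly (Suc (Suc i)) = [:2, -4:] * sin_poly (Suc i) - sin_poly i"

lemma sin_odd_mult: "sin (real (2 * i + 1) * x) = sin x * poly (sin_poly i) (sin x ^ 2)"
proof (induction i rule: sin_poly.induct)
  case 2
  have "sin (3 * x) = sin (2 * x + x)" by simp
  also have "\<dots> = sin x * (3 - 4 * sin x ^ 2)"
  proof -
    have "sin (2 * x + x) = 2 * sin x * cos x ^ 2 + (1 - 2 * sin x ^ 2) * sin x"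
      unfolding sin_add sin_double cos_double_sin by (simp add: power2_eq_square)
    then show ?thesis unfolding cos_squared_eq by (simp add: algebra_simps)
  qed
  finally show ?case by (simp add: algebra_simps)
next
  case (3 i)
  have "sin (real (2 * Suc (Suc i) + 1) * x)
      = 2 * cos (2 * x) * sin (real (2 * Suc i + 1) * x) - sin (real (2 * i + 1) * x)"
  proof -
    define a where "a = real (2 * Suc i + 1) * x"
    have "real (2 * Suc (Suc i) + 1) * x = a + 2 * x" "real (2 * i + 1) * x = a - 2 * x"
      by (simp_all add: a_def algebra_simps)
    then show ?thesis
      unfolding a_def[symmetric] by (simp only: sin_add sin_diff) simp
  qed
  also have "cos (2 * x) = 1 - 2 * sin x ^ 2"
    by (simp add: cos_double_sin)
  finally have "sin (real (2 * Suc (Suc i) + 1) * x)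
      = 2 * (1 - 2 * sin x ^ 2) * (sin x * poly (sin_poly (Suc i)) (sin x ^ 2))
        - sin x * poly (sin_poly i) (sin x ^ 2)"
    by (simp only: 3)
  also have "\<dots> = sin x * poly (sin_poly (Suc (Suc i))) (sin x ^ 2)"
    by (simp add: algebra_simps)
  finally show ?case .
qed simp

lemma degree_sin_poly: "degree (sin_poly i) \<le> i"
proof (induction i rule: sin_poly.induct)
  case (3 i)
  have "degree ([:2, -4:] * sin_poly (Suc i)) \<le> 1 + Suc i"
    using 3 by (intro order.trans[OF degree_mult_le]) simp
  moreover have "degree (sin_poly i) \<le> 1 + Suc i" using 3 by simp
  ultimately show ?case by (auto intro!: degree_diff_le)
qed simp_all

lemma coeff_sin_poly: "coeff (sin_poly i) i = (-4) ^ i"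
proof (induction i rule: sin_poly.induct)
  case (3 i)
  have "coeff (sin_poly (Suc i)) (Suc (Suc i)) = 0" "coeff (sin_poly i) (Suc (Suc i)) = 0"
    using degree_sin_poly[of "Suc i"] degree_sin_poly[of i] by (auto intro!: coeff_eq_0)
  then show ?case using 3 by simp
qed simp_all

text \<open>Each column gives up its factor sin; what remains is a matrix of polynomials in sin^2
  with leading coefficients \<open>(-4) ^ i\<close>. The Vandermonde differences factor by sin^2 a -
  sin^2 b = sin(a-b) sin(a+b).\<close>

lemma fdet_sin:
  "fdet n (\<lambda>i j. sin (real (2 * i + 1) * \<theta> j))
    = (\<Prod>i<n. sin (\<theta> i)) * (\<Prod>i<n. (-4) ^ i) * (\<Prod>i<n. \<Prod>l<i. sin (\<theta> i - \<theta> l) * sin (\<theta> i + \<theta> l))"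
proof -
  have "sin (\<theta> i - \<theta> l) * sin (\<theta> i + \<theta> l) = sin (\<theta> i) ^ 2 - sin (\<theta> l) ^ 2" for i l
  proof -
    have "sin (\<theta> i - \<theta> l) * sin (\<theta> i + \<theta> l)
        = sin (\<theta> i) ^ 2 * cos (\<theta> l) ^ 2 - cos (\<theta> i) ^ 2 * sin (\<theta> l) ^ 2"
      by (simp add: sin_diff sin_add algebra_simps power2_eq_square)
    then show ?thesis by (simp add: cos_squared_eq algebra_simps)
  qed
  then show ?thesis
    unfolding sin_odd_mult fdet_scale_columns fdet_poly[OF degree_sin_poly] fdet_vandermonde
    by (simp add: coeff_sin_poly)
qed

section \<open>The reflected kernel\<close>

definition wave :: "nat \<Rightarrow> nat \<Rightarrow> real \<Rightarrow> real" where
  "wave N b x = sin (pi * real b * x / real N)"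

text \<open>A full period of one parity is taken, so that the cosine sums below telescope to a whole
  number of turns.\<close>

definition freqs :: "nat \<Rightarrow> nat \<Rightarrow> nat set" where
  "freqs N s = {b. b < 2 * N \<and> b mod 2 = s}"

text \<open>Spectral form of the walk with steps \<open>\<plusminus>1/2\<close> reflected with sign
  at 0 and \<open>N\<close>. The factor \<open>2 / real N\<close> normalises time 0 to the indicator
  of \<open>x = y\<close>, up to a signed mirror term at \<open>x + y = real N\<close>.\<close>

definition walk_kernel :: "nat \<Rightarrow> nat \<Rightarrow> nat \<Rightarrow> real \<Rightarrow> real \<Rightarrow> real" where
  "walk_kernel N s k x y = 2 / real N *
     (\<Sum>b\<in>freqs N s. (2 * cos (pi * real b / (2 * real N))) ^ k * wave N b x * wave N b y)"

lemma wave_0 [simp]: "wave N b 0 = 0"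
  by (simp add: wave_def)

lemma wave_step:
  "wave N b (x - 1/2) + wave N b (x + 1/2) = 2 * cos (pi * real b / (2 * real N)) * wave N b x"
proof -
  have "pi * real b * (x - 1/2) / real N = pi * real b * x / real N - pi * real b / (2 * real N)"
    "pi * real b * (x + 1/2) / real N = pi * real b * x / real N + pi * real b / (2 * real N)"
    by (simp_all add: algebra_simps diff_divide_distrib add_divide_distrib)
  then show ?thesis
    unfolding wave_def by (simp only: sin_add sin_diff) simp
qed

lemma wave_reflect:
  assumes "N > 0"
  shows "wave N b (real N - x) = - ((-1) ^ b * wave N b x)"
proof -
  have "pi * real b * (real N - x) / real N = real b * pi - pi * real b * x / real N"
    using assms by (simp add: field_simps)
  then show ?thesis
    unfolding wave_def by (simp add: sin_diff)
qed

lemma walk_kernel_Suc: "walk_kernel N s (Suc k) x y = walk_kernel N s k (x - 1/2) y + walk_kernel N s k (x + 1/2) y"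
proof -
  let ?c = "\<lambda>b. 2 * cos (pi * real b / (2 * real N))"
  have "?c b ^ k * wave N b (x - 1/2) * wave N b y + ?c b ^ k * wave N b (x + 1/2) * wave N b y
      = ?c b ^ Suc k * wave N b x * wave N b y" for b
  proof -
    have "?c b ^ k * wave N b (x - 1/2) * wave N b y + ?c b ^ k * wave N b (x + 1/2) * wave N b y
        = ?c b ^ k * (wave N b (x - 1/2) + wave N b (x + 1/2)) * wave N b y"
      by (simp only: distrib_left distrib_right)
    also have "\<dots> = ?c b ^ Suc k * wave N b x * wave N b y"
      unfolding wave_step by simp
    finally show ?thesis .
  qed
  then show ?thesis
    unfolding walk_kernel_def distrib_left[symmetric] sum.distrib[symmetric] by simp
qed

lemma walk_kernel_at_0 [simp]: "walk_kernel N s k 0 y = 0"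
  by (simp add: walk_kernel_def)

text \<open>All frequencies have the parity of \<open>s\<close>, so every summand picks up the same
  sign.\<close>

lemma walk_kernel_reflect:
  assumes "N > 0"
  shows "walk_kernel N s k (real N - x) y = - ((-1) ^ s * walk_kernel N s k x y)"
proof -
  have "(-1) ^ b = ((-1) ^ s :: real)" if "b \<in> freqs N s" for b
  proof -
    have "(-1) ^ b = ((-1) ^ (2 * (b div 2) + b mod 2) :: real)" by simp
    also have "\<dots> = (-1) ^ s" using that unfolding power_add power_mult by (simp add: freqs_def)
    finally show ?thesis .
  qed
  then show ?thesis
    unfolding walk_kernel_def sum_distrib_left wave_reflect[OF assms] sum_negf[symmetric]
    by (intro sum.cong refl) simp
qed

lemma walk_kernel_at_end:
  assumes "N > 0"
  shows "walk_kernel N s k (real N) y = 0"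
  using walk_kernel_reflect[OF assms, of s k 0 y] by simp

lemma sum_freqs:
  assumes "s < 2"
  shows "(\<Sum>b\<in>freqs N s. g b) = (\<Sum>l<N. g (2 * l + s))"
proof -
  have "freqs N s = (\<lambda>l. 2 * l + s) ` {..<N}"
  proof (intro equalityI subsetI)
    fix b assume "b \<in> freqs N s"
    then have "b = 2 * (b div 2) + s" "b div 2 < N" by (auto simp: freqs_def)
    then show "b \<in> (\<lambda>l. 2 * l + s) ` {..<N}" by blast
  qed (use assms in \<open>auto simp: freqs_def\<close>)
  moreover have "inj_on (\<lambda>l. 2 * l + s) {..<N}" by (auto intro: inj_onI)
  ultimately show ?thesis by (simp add: sum.reindex)
qed

lemma sum_cos_freqs:
  assumes "s < 2" "z \<in> \<int>" "- real N < z" "z < 2 * real N" "N > 0"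
  shows "(\<Sum>b\<in>freqs N s. cos (pi * real b * z / real N))
    = real N * ((if z = 0 then 1 else 0) + (-1) ^ s * (if z = real N then 1 else 0))"
proof -
  define a where "a = pi * z / real N"
  have S: "(\<Sum>b\<in>freqs N s. cos (pi * real b * z / real N)) = (\<Sum>l<N. cos (real (2 * l + s) * a))"
    unfolding sum_freqs[OF assms(1)] a_def by (intro sum.cong refl arg_cong[of _ _ cos]) simp
  consider "z = 0" | "z = real N" | "z \<noteq> 0" "z \<noteq> real N" by blast
  then show ?thesis
  proof cases
    case 1
    then show ?thesis using S assms(5) by (simp add: a_def)
  next
    case 2
    then have "a = pi" using assms(5) by (simp add: a_def)
    then have "cos (real (2 * l + s) * a) = (-1) ^ s" for l
      using cos_npi[of "2 * l + s"] by (simp only:) (simp add: power_add power_mult)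
    then show ?thesis unfolding S using 2 assms(5) by simp
  next
    case 3
    have "sin a \<noteq> 0"
    proof -
      consider "z < 0" | "0 < z" "z < real N" | "real N < z" using 3 by linarith
      then show ?thesis
      proof cases
        case 1
        then have "pi * z < 0" "- (pi * z) < pi * real N"
          using mult_pos_neg[OF pi_gt_zero, of z] mult_strict_left_mono[of "- z" "real N" pi] assms
          by simp_all
        then have "0 < - a" "- a < pi" using assms(5) by (simp_all add: a_def field_simps)
        then have "sin (- a) > 0" by (rule sin_gt_zero)
        then show ?thesis by simp
      next
        case 2
        then have "0 < a" "a < pi" using assms by (simp_all add: a_def field_simps)
        then show ?thesis using sin_gt_zero by force
      next
        case 3
        then have "pi < a" "a < 2 * pi" using assms by (simp_all add: a_def field_simps)
        then show ?thesis using sin_lt_zero by force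
      qed
    qed
    have tel: "2 * sin a * cos (real (2 * l + s) * a)
        = sin ((real (2 * Suc l) + real s - 1) * a) - sin ((real (2 * l) + real s - 1) * a)" for l
    proof -
      have "(real (2 * Suc l) + real s - 1) * a = real (2 * l + s) * a + a"
        "(real (2 * l) + real s - 1) * a = real (2 * l + s) * a - a"
        by (simp_all add: algebra_simps)
      then show ?thesis by (simp only: sin_add sin_diff) simp
    qed
    have "2 * sin a * (\<Sum>l<N. cos (real (2 * l + s) * a))
        = sin ((real (2 * N) + real s - 1) * a) - sin ((real s - 1) * a)"
      unfolding sum_distrib_left tel
      using sum_lessThan_telescope[of "\<lambda>l. sin ((real (2 * l) + real s - 1) * a)" N] by simp
    also have "(real (2 * N) + real s - 1) * a = (real s - 1) * a + 2 * pi * z"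
      using assms(5) by (simp add: a_def field_simps)
    also have "sin ((real s - 1) * a + 2 * pi * z) - sin ((real s - 1) * a) = 0"
      using assms(2) by (simp add: sin_add sin_integer_2pi cos_integer_2pi)
    finally show ?thesis unfolding S using 3 \<open>sin a \<noteq> 0\<close> by simp
  qed
qed

text \<open>A product of two waves is half the difference of cosines at \<open>x - y\<close> and
  \<open>x + y\<close>, and each cosine sum is known by orthogonality.\<close>

lemma walk_kernel_0:
  assumes "s < 2" "x - y \<in> \<int>" "x + y \<in> \<int>" "0 < x" "x < real N" "0 < y" "y < real N"
  shows "walk_kernel N s 0 x y
    = (if x = y then 1 else 0) - (-1) ^ s * (if x + y = real N then 1 else 0)"
proof -
  have N: "N > 0" using assms by (cases N) auto
  have w: "wave N b x * wave N b y
      = (cos (pi * real b * (x - y) / real N) - cos (pi * real b * (x + y) / real N)) / 2" for b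
    unfolding wave_def sin_times_sin by (simp add: algebra_simps diff_divide_distrib add_divide_distrib)
  have scale: "2 / c * ((A - B) / 2) = 1 / c * (A - B)" for A B c :: real
    by (cases "c = 0") (simp_all add: field_simps)
  have "walk_kernel N s 0 x y = 2 / real N * (\<Sum>b\<in>freqs N s.
      (cos (pi * real b * (x - y) / real N) - cos (pi * real b * (x + y) / real N)) / 2)"
    unfolding walk_kernel_def by (simp only: power_0 mult_1 w)
  also have "\<dots> = 1 / real N *
      ((\<Sum>b\<in>freqs N s. cos (pi * real b * (x - y) / real N))
       - (\<Sum>b\<in>freqs N s. cos (pi * real b * (x + y) / real N)))"
    unfolding sum_divide_distrib[symmetric] sum_subtractf by (rule scale)
  also have "\<dots> = 1 / real N *
      (real N * (if x = y then 1 else 0) - real N * ((-1) ^ s * (if x + y = real N then 1 else 0)))"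
    using assms N by (simp add: sum_cos_freqs)
  finally show ?thesis using N by (simp only: right_diff_distrib) simp
qed

section \<open>Counting walks\<close>

text \<open>The step set is symmetric, so these are the predecessors of \<open>y\<close> as well as
  its successors.\<close>

definition neighbours :: "nat \<Rightarrow> (nat \<Rightarrow> real) \<Rightarrow> (nat \<Rightarrow> real) set" where
  "neighbours n y = PiE {1..n} (\<lambda>j. {y j - 1/2, y j + 1/2})"

lemma finite_neighbours [simp]: "finite (neighbours n y)"
  by (auto simp: neighbours_def intro: finite_PiE)

lemma neighbour_cases:
  assumes "q \<in> neighbours n y" "j \<in> {1..n}"
  shows "q j = y j - 1/2 \<or> q j = y j + 1/2"
  using PiE_mem[OF assms(1)[unfolded neighbours_def] assms(2)] by simp

lemma diagonal_walks_0:
  assumes "\<eta> \<in> R"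
  shows "diagonal_walks n R \<eta> y 0 = (if y = \<eta> then {\<lambda>i\<in>{0}. \<eta>} else {})"
  using assms by (auto simp: diagonal_walks_def PiE_iff extensional_def fun_eq_iff)

lemma diagonal_walks_Suc:
  assumes R: "R \<subseteq> {1..n} \<rightarrow>\<^sub>E UNIV" and y: "y \<in> R"
  shows "diagonal_walks n R \<eta> y (Suc k)
    = (\<Union>q\<in>neighbours n y \<inter> R. (\<lambda>p. p(Suc k := y)) ` diagonal_walks n R \<eta> q k)"
proof (intro equalityI subsetI)
  fix p assume "p \<in> diagonal_walks n R \<eta> y (Suc k)"
  then have p: "p \<in> {0..Suc k} \<rightarrow>\<^sub>E R" "p 0 = \<eta>" "p (Suc k) = y"
    and step: "\<And>i j. i \<in> {1..Suc k} \<Longrightarrow> j \<in> {1..n} \<Longrightarrow> p i j - p (i - 1) j \<in> {1/2, -1/2}"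
    by (auto simp: diagonal_walks_def)
  have pR: "p i \<in> R" if "i \<le> Suc k" for i using p(1) that by (auto simp: PiE_iff)
  \<comment> \<open>Erasing the last time makes the shortened walk extensional on
    \<open>{0..k}\<close>.\<close>
  let ?p = "p(Suc k := undefined)"
  have "p k \<in> neighbours n y"
    unfolding neighbours_def
  proof (rule PiE_I)
    fix j assume "j \<in> {1..n}"
    then show "p k j \<in> {y j - 1/2, y j + 1/2}" using step[of "Suc k" j] p(3) by auto
  next
    fix j assume "j \<notin> {1..n}"
    moreover have "p k \<in> {1..n} \<rightarrow>\<^sub>E UNIV" using pR[of k] R by auto
    ultimately show "p k j = undefined" by (auto simp: PiE_iff extensional_def)
  qed
  moreover have "?p \<in> diagonal_walks n R \<eta> (p k) k"
    unfolding diagonal_walks_def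
  proof (intro CollectI conjI ballI)
    show "?p \<in> {0..k} \<rightarrow>\<^sub>E R" using p(1) by (auto simp: PiE_iff extensional_def)
    fix i j assume "i \<in> {1..k}" "j \<in> {1..n}"
    moreover from this have "i \<noteq> Suc k" "i - 1 \<noteq> Suc k" by auto
    ultimately show "?p i j - ?p (i - 1) j \<in> {1/2, -1/2}" using step[of i j] by simp
  qed (use p in auto)
  moreover have "p = ?p(Suc k := y)" using p(3) by auto
  moreover have "p k \<in> R" using pR[of k] by simp
  ultimately show "p \<in> (\<Union>q\<in>neighbours n y \<inter> R. (\<lambda>p. p(Suc k := y)) ` diagonal_walks n R \<eta> q k)"
    by (intro UN_I[of "p k"] IntI image_eqI)
next
  fix p assume "p \<in> (\<Union>q\<in>neighbours n y \<inter> R. (\<lambda>p. p(Suc k := y)) ` diagonal_walks n R \<eta> q k)"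
  then obtain q r where q: "q \<in> neighbours n y" and r: "r \<in> diagonal_walks n R \<eta> q k"
    and p: "p = r(Suc k := y)" by blast
  from r have r': "r \<in> {0..k} \<rightarrow>\<^sub>E R" "r 0 = \<eta>" "r k = q"
    and step: "\<And>i j. i \<in> {1..k} \<Longrightarrow> j \<in> {1..n} \<Longrightarrow> r i j - r (i - 1) j \<in> {1/2, -1/2}"
    by (auto simp: diagonal_walks_def)
  show "p \<in> diagonal_walks n R \<eta> y (Suc k)"
    unfolding diagonal_walks_def
  proof (intro CollectI conjI ballI)
    show "p \<in> {0..Suc k} \<rightarrow>\<^sub>E R" using r'(1) y p by (auto simp: PiE_iff extensional_def)
    fix i j assume i: "i \<in> {1..Suc k}" and j: "j \<in> {1..n}"
    show "p i j - p (i - 1) j \<in> {1/2, -1/2}"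
    proof (cases "i = Suc k")
      case True
      then show ?thesis using neighbour_cases[OF q j] r'(3) by (auto simp: p)
    next
      case False
      moreover from this have "i - 1 \<noteq> Suc k" using i by auto
      ultimately show ?thesis using step[of i j] i j p by simp
    qed
  qed (use r' p in auto)
qed

lemma finite_diagonal_walks:
  assumes "R \<subseteq> {1..n} \<rightarrow>\<^sub>E UNIV" "\<eta> \<in> R" "y \<in> R"
  shows "finite (diagonal_walks n R \<eta> y k)"
  using assms(3)
proof (induction k arbitrary: y)
  case 0
  then show ?case using assms by (simp add: diagonal_walks_0)
next
  case (Suc k)
  show ?case
    unfolding diagonal_walks_Suc[OF assms(1) Suc.prems]
    by (intro finite_UN_I finite_imageI Suc.IH) auto
qed

text \<open>A shortened walk is \<open>undefined\<close> at \<open>Suc k\<close>, so it can be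
  recovered from its extension. Hence the extension maps are injective, and their images for
  different penultimate points are disjoint.\<close>

lemma card_diagonal_walks_Suc:
  assumes R: "R \<subseteq> {1..n} \<rightarrow>\<^sub>E UNIV" and "\<eta> \<in> R" "y \<in> R"
  shows "card (diagonal_walks n R \<eta> y (Suc k))
    = (\<Sum>q\<in>neighbours n y \<inter> R. card (diagonal_walks n R \<eta> q k))"
proof -
  let ?h = "\<lambda>p. p(Suc k := y)"
  have und: "p (Suc k) = undefined" if "p \<in> diagonal_walks n R \<eta> q k" for p q
    using that by (auto simp: diagonal_walks_def PiE_iff extensional_def)
  have eq: "p = p'"
    if "p \<in> diagonal_walks n R \<eta> q k" "p' \<in> diagonal_walks n R \<eta> q' k" "?h p = ?h p'" for p p' q q'
  proof
    fix x show "p x = p' x"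
      using fun_cong[OF that(3), of x] und[OF that(1)] und[OF that(2)] by (cases "x = Suc k") auto
  qed
  have "card (diagonal_walks n R \<eta> y (Suc k))
      = (\<Sum>q\<in>neighbours n y \<inter> R. card (?h ` diagonal_walks n R \<eta> q k))"
    unfolding diagonal_walks_Suc[OF assms(1,3)]
  proof (rule card_UN_disjoint)
    show "\<forall>q\<in>neighbours n y \<inter> R. finite (?h ` diagonal_walks n R \<eta> q k)"
      using assms by (intro ballI finite_imageI finite_diagonal_walks) auto
    show "\<forall>q\<in>neighbours n y \<inter> R. \<forall>q'\<in>neighbours n y \<inter> R. q \<noteq> q' \<longrightarrow>
        ?h ` diagonal_walks n R \<eta> q k \<inter> ?h ` diagonal_walks n R \<eta> q' k = {}"
    proof (intro ballI impI)
      fix q q' :: "nat \<Rightarrow> real" assume "q \<noteq> q'"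
      have False if "p \<in> diagonal_walks n R \<eta> q k" "p' \<in> diagonal_walks n R \<eta> q' k" "?h p = ?h p'" for p p'
        using eq[OF that] that(1,2) \<open>q \<noteq> q'\<close> by (auto simp: diagonal_walks_def)
      then show "?h ` diagonal_walks n R \<eta> q k \<inter> ?h ` diagonal_walks n R \<eta> q' k = {}" by blast
    qed
  qed simp
  also have "\<dots> = (\<Sum>q\<in>neighbours n y \<inter> R. card (diagonal_walks n R \<eta> q k))"
    by (intro sum.cong refl card_image inj_onI) (rule eq)
  finally show ?thesis .
qed

section \<open>Determinants of kernels and their recursion\<close>

text \<open>Vectors are indexed from \<open>1\<close>, the rows and columns of determinants from \<open>0\<close>.\<close>

definition wdet :: "nat \<Rightarrow> nat \<Rightarrow> nat \<Rightarrow> nat \<Rightarrow> (nat \<Rightarrow> real) \<Rightarrow> (nat \<Rightarrow> real) \<Rightarrow> real" where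
  "wdet n N s k y \<eta> = fdet n (\<lambda>i j. walk_kernel N s k (y (Suc i)) (\<eta> (Suc j)))"

text \<open>Passes from the choice functions of a row expansion, indexed from 0, to vectors, indexed
  from 1. The value \<open>undefined\<close> off the index range makes the two shifts mutually
  inverse.\<close>

lemma sum_PiE_shift:
  "(\<Sum>q\<in>PiE {..<n} (\<lambda>i. B (Suc i)). g (\<lambda>i. q i))
    = (\<Sum>q\<in>PiE {1..n} B. g (\<lambda>i. if i < n then q (Suc i) else undefined))"
proof (rule sum.reindex_bij_witness[of _ "\<lambda>q i. if i < n then q (Suc i) else undefined"
      "\<lambda>q i. if i \<in> {1..n} then q (i - 1) else undefined"], goal_cases)
  case (1 q)
  show ?case
  proof
    fix i show "(if i < n then if Suc i \<in> {1..n} then q (Suc i - 1) else undefined else undefined) = q i"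
      using 1 by (auto simp: PiE_iff extensional_def)
  qed
next
  case (2 q)
  show ?case
    unfolding PiE_iff extensional_def
  proof (intro conjI ballI)
    fix i assume "i \<in> {1..n}"
    then obtain l where "i = Suc l" "l < n" by (cases i) auto
    then show "(if i \<in> {1..n} then q (i - 1) else undefined) \<in> B i" using 2 by (auto simp: PiE_iff)
  qed auto
next
  case (3 q)
  show ?case
  proof
    fix i show "(if i \<in> {1..n} then if i - 1 < n then q (Suc (i - 1)) else undefined else undefined) = q i"
      using 3 by (cases i) (auto simp: PiE_iff extensional_def)
  qed
next
  case (4 q)
  then show ?case by (auto simp: PiE_iff extensional_def)
next
  case (5 q)
  have "(\<lambda>i. if i < n then if Suc i \<in> {1..n} then q (Suc i - 1) else undefined else undefined) = q"
    using 5 by (auto simp: PiE_iff extensional_def fun_eq_iff)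
  then show ?case by simp
qed

text \<open>Row \<open>i\<close> at time \<open>Suc k\<close> is the sum of two rows at time
  \<open>k\<close>, so expanding all rows yields every sign pattern once.\<close>

lemma wdet_Suc: "wdet n N s (Suc k) y \<eta> = (\<Sum>q\<in>neighbours n y. wdet n N s k q \<eta>)"
proof -
  \<comment> \<open>The factor \<open>1\<close> supplies the coefficients that
    \<open>fdet_row_sums\<close> expects.\<close>
  have "wdet n N s (Suc k) y \<eta> = fdet n (\<lambda>i j. \<Sum>z\<in>{y (Suc i) - 1/2, y (Suc i) + 1/2}.
      1 * walk_kernel N s k z (\<eta> (Suc j)))"
    unfolding wdet_def walk_kernel_Suc by (intro fdet_cong) simp
  also have "\<dots> = (\<Sum>q\<in>PiE {..<n} (\<lambda>i. {y (Suc i) - 1/2, y (Suc i) + 1/2}).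
      fdet n (\<lambda>i j. walk_kernel N s k (q i) (\<eta> (Suc j))))"
    by (subst fdet_row_sums) simp_all
  also have "\<dots> = (\<Sum>q\<in>neighbours n y.
      fdet n (\<lambda>i j. walk_kernel N s k (if i < n then q (Suc i) else undefined) (\<eta> (Suc j))))"
    unfolding neighbours_def by (rule sum_PiE_shift)
  also have "\<dots> = (\<Sum>q\<in>neighbours n y. wdet n N s k q \<eta>)"
    unfolding wdet_def by (intro sum.cong refl fdet_cong) simp
  finally show ?thesis .
qed

lemma wdet_dependent_rows:
  assumes "i \<in> {1..n}" "i' \<in> {1..n}" "i \<noteq> i'"
    and "\<And>x. walk_kernel N s k (q i) x = a * walk_kernel N s k (q i') x"
  shows "wdet n N s k q \<eta> = 0"
  unfolding wdet_def
  by (rule fdet_proportional_rows[of "i - 1" n "i' - 1" _ a]) (use assms in auto)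

lemma wdet_zero_row:
  assumes "i \<in> {1..n}" "\<And>x. walk_kernel N s k (q i) x = 0"
  shows "wdet n N s k q \<eta> = 0"
  unfolding wdet_def by (rule fdet_zero_row[of "i - 1"]) (use assms in auto)

text \<open>The lattice of points reachable in \<open>k\<close> half steps, which move each
  coordinate by \<open>k / 2\<close> modulo integers. Including sums keeps mirror images on the
  lattice and makes twice each coordinate integral.\<close>

definition aligned :: "nat \<Rightarrow> nat \<Rightarrow> (nat \<Rightarrow> real) \<Rightarrow> (nat \<Rightarrow> real) \<Rightarrow> bool" where
  "aligned n k y \<eta> \<longleftrightarrow> (\<forall>i\<in>{1..n}. \<forall>j\<in>{1..n}.
     y i - \<eta> j - real k / 2 \<in> \<int> \<and> y i + \<eta> j - real k / 2 \<in> \<int>)"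

lemma aligned_diff_sum:
  assumes "aligned n k y \<eta>" "i \<in> {1..n}" "j \<in> {1..n}"
  shows "y i - y j \<in> \<int>" "y i + y j \<in> \<int>"
proof -
  have *: "y i - \<eta> j - real k / 2 \<in> \<int>" "y j - \<eta> j - real k / 2 \<in> \<int>" "y j + \<eta> j - real k / 2 \<in> \<int>"
    using assms unfolding aligned_def by blast+
  have "y i - y j = (y i - \<eta> j - real k / 2) - (y j - \<eta> j - real k / 2)"
    "y i + y j = (y i - \<eta> j - real k / 2) + (y j + \<eta> j - real k / 2) + real k"
    by simp_all
  then show "y i - y j \<in> \<int>" "y i + y j \<in> \<int>"
    using * by (simp_all only: Ints_add Ints_diff Ints_of_nat)
qed

lemma aligned_neighbour:
  assumes "aligned n (Suc k) y \<eta>" "q \<in> neighbours n y"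
  shows "aligned n k q \<eta>"
  unfolding aligned_def
proof (intro ballI)
  fix i j assume ij: "i \<in> {1..n}" "j \<in> {1..n}"
  have *: "y i - \<eta> j - real (Suc k) / 2 \<in> \<int>" "y i + \<eta> j - real (Suc k) / 2 \<in> \<int>"
    using assms(1) ij unfolding aligned_def by blast+
  consider "q i = y i - 1/2" | "q i = y i + 1/2"
    using neighbour_cases[OF assms(2) ij(1)] by blast
  then show "q i - \<eta> j - real k / 2 \<in> \<int> \<and> q i + \<eta> j - real k / 2 \<in> \<int>"
  proof cases
    case 1
    then have "q i - \<eta> j - real k / 2 = y i - \<eta> j - real (Suc k) / 2"
      "q i + \<eta> j - real k / 2 = y i + \<eta> j - real (Suc k) / 2"
      by (simp_all add: field_simps)
    then show ?thesis using * by (simp only: simp_thms)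
  next
    case 2
    then have "q i - \<eta> j - real k / 2 = (y i - \<eta> j - real (Suc k) / 2) + 1"
      "q i + \<eta> j - real k / 2 = (y i + \<eta> j - real (Suc k) / 2) + 1"
      by (simp_all add: field_simps)
    then show ?thesis using * by (simp only: Ints_add Ints_1 simp_thms)
  qed
qed

lemma Ints_less_imp_add_one_le:
  fixes x y :: real
  assumes "x \<in> \<int>" "y \<in> \<int>" "x < y"
  shows "x + 1 \<le> y"
proof -
  obtain a b :: int where "x = of_int a" "y = of_int b" using assms by (auto elim!: Ints_cases)
  moreover from this have "a + 1 \<le> b" using assms(3) by simp
  then have "real_of_int (a + 1) \<le> real_of_int b" by (simp only: of_int_le_iff)
  ultimately show ?thesis by simp
qed

section \<open>The walls of the alcove and the counting formula\<close>

context
  fixes n N :: nat and m :: real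
  assumes n: "n \<ge> 1" and N: "real N = 2 * m" "N > 0"
begin

lemma alcove_less: "x \<in> alcove_B n m \<Longrightarrow> 1 \<le> i \<Longrightarrow> i < j \<Longrightarrow> j \<le> n \<Longrightarrow> x j < x i"
  by (auto simp: alcove_B_def)

lemma alcove_le: "x \<in> alcove_B n m \<Longrightarrow> 1 \<le> i \<Longrightarrow> i \<le> j \<Longrightarrow> j \<le> n \<Longrightarrow> x j \<le> x i"
  using alcove_less[of x i j] by (cases "i = j") auto

lemma alcove_pos: "x \<in> alcove_B n m \<Longrightarrow> i \<in> {1..n} \<Longrightarrow> 0 < x i"
  using alcove_le[of x i n] by (auto simp: alcove_B_def)

lemma alcove_add_less:
  assumes "x \<in> alcove_B n m" "1 \<le> i" "i < j" "j \<le> n"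
  shows "x i + x j < real N"
proof -
  have "x 1 + x 2 < real N" using assms N by (auto simp: alcove_B_def)
  moreover have "x i \<le> x 1" "x j \<le> x 2" using assms by (auto intro: alcove_le)
  ultimately show ?thesis by simp
qed

lemma alcove_less_N:
  assumes "x \<in> alcove_B n m" "i \<in> {1..n}"
  shows "x i < real N"
proof -
  have "x 1 < real N"
  proof (cases "n \<ge> 2")
    case True
    then show ?thesis using alcove_add_less[of x 1 2] alcove_pos[of x 2] assms by simp
  next
    case False
    then show ?thesis using assms N by (simp add: alcove_B_def)
  qed
  then show ?thesis using alcove_le[of x 1 i] assms by simp
qed

text \<open>A diagonal step moves each coordinate and each sum or difference of two coordinates by
  less than it takes to jump over a wall, so a walk leaving the alcove lands on a wall, where two
  rows of the determinant are proportional or one vanishes.\<close>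

lemma wdet_outside:
  assumes y: "y \<in> alcove_B n m" "aligned n k' y \<eta>"
    and q: "q \<in> neighbours n y" "q \<notin> alcove_B n m"
  shows "wdet n N s k q \<eta> = 0"
proof -
  note near = neighbour_cases[OF q(1)]
  have "q \<in> {1..n} \<rightarrow>\<^sub>E UNIV" using q(1) by (auto simp: neighbours_def PiE_iff)
  then consider (a) i j where "1 \<le> i" "i < j" "j \<le> n" "q i \<le> q j" | (b) "q n \<le> 0"
    | (c) "2 \<le> n" "real N \<le> q 1 + q 2" | (d) "n = 1" "real N \<le> q 1"
    using q(2) n N unfolding alcove_B_def by (auto simp: not_less split: if_splits)
  then show ?thesis
  proof cases
    case a
    have "y j - y i \<in> \<int>" "y j - y i < 0"
      using aligned_diff_sum(1)[OF y(2), of j i] alcove_less[OF y(1), of i j] a by auto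
    then have "y j - y i + 1 \<le> 0" using Ints_less_imp_add_one_le[of "y j - y i" 0] by simp
    then have "q i = q j" using near[of i] near[of j] a by auto
    then show ?thesis using a by (intro wdet_dependent_rows[of i n j _ _ _ _ 1]) auto
  next
    case b
    \<comment> \<open>Twice the last coordinate is a positive integer, so
      \<open>y n \<ge> 1/2\<close> and a half step down can at most reach 0.\<close>
    have "y n + y n \<in> \<int>" "0 < y n"
      using aligned_diff_sum(2)[OF y(2), of n n] alcove_pos[OF y(1), of n] n by auto
    then have "0 + 1 \<le> y n + y n" by (intro Ints_less_imp_add_one_le) auto
    then have "q n = 0" using near[of n] b n by auto
    then show ?thesis using n by (intro wdet_zero_row[of n]) auto
  next
    case c
    have "y 1 + y 2 \<in> \<int>" "y 1 + y 2 < real N"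
      using aligned_diff_sum(2)[OF y(2), of 1 2] alcove_add_less[OF y(1), of 1 2] c by auto
    then have "y 1 + y 2 + 1 \<le> real N" by (intro Ints_less_imp_add_one_le) auto
    then have "q 1 = real N - q 2" using near[of 1] near[of 2] c by auto
    \<comment> \<open>The first two coordinates are mirror images, so their rows are proportional
      with the same factor in every column.\<close>
    then have "walk_kernel N s k (q 1) x = - ((-1) ^ s) * walk_kernel N s k (q 2) x" for x
      using walk_kernel_reflect[OF N(2)] by simp
    then show ?thesis using c by (intro wdet_dependent_rows[of 1 n 2 _ _ _ _ "- ((-1) ^ s)"]) auto
  next
    case d
    \<comment> \<open>For \<open>n = 1\<close> the upper wall is the point \<open>N\<close>, where
      the kernel itself vanishes.\<close>
    have "y 1 + y 1 \<in> \<int>" "y 1 + y 1 < 2 * real N"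
      using aligned_diff_sum(2)[OF y(2), of 1 1] alcove_less_N[OF y(1), of 1] d by auto
    then have "y 1 + y 1 + 1 \<le> 2 * real N" by (intro Ints_less_imp_add_one_le) auto
    then have "q 1 = real N" using near[of 1] d by auto
    then show ?thesis using walk_kernel_at_end[OF N(2)] n by (intro wdet_zero_row[of 1]) auto
  qed
qed

text \<open>Folding \<open>(0, N)\<close> onto \<open>(0, N/2]\<close> keeps the coordinates of a point of the alcove in
  strictly decreasing order, so at time \<open>0\<close> only the diagonal of the matrix matters.\<close>

lemma wdet_0:
  assumes y: "y \<in> alcove_B n m" and \<eta>: "\<eta> \<in> alcove_B n m" and al: "aligned n 0 y \<eta>" and s: "s < 2"
  shows "wdet n N s 0 y \<eta> = (\<Prod>i<n. if y (Suc i) = \<eta> (Suc i) then 1 else 0)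
    - (-1) ^ s * (if y 1 + \<eta> 1 = real N then 1 else 0)
      * (\<Prod>i\<in>{1..<n}. if y (Suc i) = \<eta> (Suc i) then 1 else 0)"
proof -
  define fold where "fold x = min x (real N - x)" for x
  have fold: "fold (x (Suc j)) < fold (x (Suc i))"
    if x: "x \<in> alcove_B n m" and ij: "i < j" "j < n" for x i j
  proof -
    have "x (Suc j) < x (Suc i)" "x (Suc i) + x (Suc j) < real N"
      using alcove_less[OF x, of "Suc i" "Suc j"] alcove_add_less[OF x, of "Suc i" "Suc j"] ij by auto
    then show ?thesis by (auto simp: fold_def min_def)
  qed
  have K: "walk_kernel N s 0 (y (Suc i)) (\<eta> (Suc j)) = (if y (Suc i) = \<eta> (Suc j) then 1 else 0)
      - (-1) ^ s * (if y (Suc i) + \<eta> (Suc j) = real N then 1 else 0)" if "i < n" "j < n" for i j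
    using that al s alcove_pos[OF y, of "Suc i"] alcove_pos[OF \<eta>, of "Suc j"]
      alcove_less_N[OF y, of "Suc i"] alcove_less_N[OF \<eta>, of "Suc j"]
    by (intro walk_kernel_0) (auto simp: aligned_def)
  have "wdet n N s 0 y \<eta> = (\<Prod>i<n. walk_kernel N s 0 (y (Suc i)) (\<eta> (Suc i)))"
    unfolding wdet_def
  proof (rule fdet_eq_diagonal_prod[of _ "\<lambda>i. fold (y (Suc i))" "\<lambda>j. fold (\<eta> (Suc j))"])
    fix i j assume "i < n" "j < n" "walk_kernel N s 0 (y (Suc i)) (\<eta> (Suc j)) \<noteq> 0"
    then have "y (Suc i) = \<eta> (Suc j) \<or> y (Suc i) + \<eta> (Suc j) = real N"
      using K[of i j] by (auto split: if_splits)
    then show "fold (y (Suc i)) = fold (\<eta> (Suc j))" by (auto simp: fold_def min_def)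
  qed (use y \<eta> in \<open>auto intro: fold\<close>)
  also have "\<dots> = walk_kernel N s 0 (y 1) (\<eta> 1) * (\<Prod>i\<in>{1..<n}. walk_kernel N s 0 (y (Suc i)) (\<eta> (Suc i)))"
    using n by (simp add: lessThan_atLeast0 prod.atLeast_Suc_lessThan)
  also have "(\<Prod>i\<in>{1..<n}. walk_kernel N s 0 (y (Suc i)) (\<eta> (Suc i)))
      = (\<Prod>i\<in>{1..<n}. if y (Suc i) = \<eta> (Suc i) then 1 else 0)"
  proof (rule prod.cong)
    fix i assume i: "i \<in> {1..<n}"
    \<comment> \<open>Only the first coordinate can reach \<open>N/2\<close>: every later one is
      smaller than \<open>x 1\<close>, and their sum is below \<open>N\<close>. Hence the mirror
      term survives in the first row alone.\<close>
    have "x (Suc i) < real N / 2" if x: "x \<in> alcove_B n m" for x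
      using alcove_less[OF x, of 1 "Suc i"] alcove_add_less[OF x, of 1 "Suc i"] i by simp
    from this[OF y] this[OF \<eta>] have "y (Suc i) + \<eta> (Suc i) \<noteq> real N" by linarith
    then show "walk_kernel N s 0 (y (Suc i)) (\<eta> (Suc i)) = (if y (Suc i) = \<eta> (Suc i) then 1 else 0)"
      using K[of i i] i by simp
  qed simp
  also have "walk_kernel N s 0 (y 1) (\<eta> 1)
      = (if y 1 = \<eta> 1 then 1 else 0) - (-1) ^ s * (if y 1 + \<eta> 1 = real N then 1 else 0)"
    using K[of 0 0] n by simp
  finally show ?thesis
    using n by (simp add: lessThan_atLeast0 prod.atLeast_Suc_lessThan left_diff_distrib)
qed

text \<open>Both sides obey the same recursion, because the determinants vanish at neighbours
  outside the alcove. At time 0 the mirror terms have opposite signs for \<open>s = 0\<close> and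
  \<open>s = 1\<close>, so they cancel in the mean.\<close>

theorem card_diagonal_walks_eq:
  assumes \<eta>: "\<eta> \<in> alcove_B n m" and "y \<in> alcove_B n m" "aligned n k y \<eta>"
  shows "real (card (diagonal_walks n (alcove_B n m) \<eta> y k))
    = (wdet n N 0 k y \<eta> + wdet n N 1 k y \<eta>) / 2"
  using assms(2,3)
proof (induction k arbitrary: y)
  case 0
  have "(\<Prod>i<n. if y (Suc i) = \<eta> (Suc i) then 1 else 0) = (if y = \<eta> then 1 else 0 :: real)"
  proof (cases "y = \<eta>")
    case False
    have "\<exists>j\<in>{1..n}. y j \<noteq> \<eta> j"
    proof (rule ccontr)
      assume "\<not> (\<exists>j\<in>{1..n}. y j \<noteq> \<eta> j)"
      then have "y = \<eta>"
        using 0(1) \<eta> by (intro PiE_ext[of y "{1..n}" _ \<eta>]) (auto simp: alcove_B_def)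
      then show False using False by simp
    qed
    then obtain j where "j \<in> {1..n}" "y j \<noteq> \<eta> j" by blast
    then have "(\<Prod>i<n. if y (Suc i) = \<eta> (Suc i) then 1 else 0 :: real) = 0"
      by (intro prod_zero bexI[of _ "j - 1"]) auto
    then show ?thesis using False by simp
  qed simp
  then show ?case
    using wdet_0[OF 0(1) \<eta> 0(2), of 0] wdet_0[OF 0(1) \<eta> 0(2), of 1] \<eta>
    by (simp add: diagonal_walks_0)
next
  case (Suc k)
  let ?R = "alcove_B n m"
  have R: "?R \<subseteq> {1..n} \<rightarrow>\<^sub>E UNIV" by (auto simp: alcove_B_def)
  have "real (card (diagonal_walks n ?R \<eta> y (Suc k)))
      = (\<Sum>q\<in>neighbours n y \<inter> ?R. real (card (diagonal_walks n ?R \<eta> q k)))"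
    using card_diagonal_walks_Suc[OF R \<eta> Suc.prems(1)] by simp
  also have "\<dots> = (\<Sum>q\<in>neighbours n y \<inter> ?R. (wdet n N 0 k q \<eta> + wdet n N 1 k q \<eta>) / 2)"
    using aligned_neighbour[OF Suc.prems(2)] by (intro sum.cong refl Suc.IH) auto
  also have "\<dots> = (\<Sum>q\<in>neighbours n y. (wdet n N 0 k q \<eta> + wdet n N 1 k q \<eta>) / 2)"
    using wdet_outside[OF Suc.prems] by (intro sum.mono_neutral_left) auto
  also have "\<dots> = (wdet n N 0 (Suc k) y \<eta> + wdet n N 1 (Suc k) y \<eta>) / 2"
    unfolding wdet_Suc by (simp only: sum.distrib flip: sum_divide_distrib)
  finally show ?case .
qed

end

section \<open>The leading term\<close>

definition amplitude :: "nat \<Rightarrow> nat \<Rightarrow> real" where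
  "amplitude N b = 2 * cos (pi * real b / (2 * real N))"

definition low_freqs :: "nat \<Rightarrow> nat \<Rightarrow> nat set" where
  "low_freqs N s = {b. 0 < b \<and> b < N \<and> b mod 2 = s}"

lemma finite_low_freqs [simp]: "finite (low_freqs N s)"
  by (rule finite_subset[of _ "{..<N}"]) (auto simp: low_freqs_def)

text \<open>The frequencies \<open>b\<close> and \<open>2 N - b\<close> contribute equally at even times.\<close>

lemma walk_kernel_even:
  assumes "even k" "k > 0" "N > 0" and xy: "x - y \<in> \<int>" "x + y \<in> \<int>"
  shows "walk_kernel N s k x y
    = (\<Sum>b\<in>low_freqs N s. 4 / real N * amplitude N b ^ k * wave N b x * wave N b y)"
proof -
  define g where "g b = amplitude N b ^ k * wave N b x * wave N b y" for b
  \<comment> \<open>Since \<open>2 * x\<close> and \<open>2 * y\<close> are integers, replacing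
    \<open>b\<close> by \<open>2 * N - b\<close> changes each wave only by a sign. The two signs
    agree because \<open>x - y\<close> is integral, so they cancel in the product.\<close>
  have "x + x \<in> \<int>" "y + y \<in> \<int>"
    using Ints_add[OF xy] Ints_diff[OF xy(2,1)] by simp_all
  then have "sin (2 * pi * x) = 0" "sin (2 * pi * y) = 0"
    using sin_times_pi_eq_0[of "x + x"] sin_times_pi_eq_0[of "y + y"] by (simp_all add: algebra_simps)
  then have w: "wave N (2 * N - b) z = - cos (2 * pi * z) * wave N b z"
    if "b \<le> 2 * N" "z = x \<or> z = y" for b z
  proof -
    assume sin0: "sin (2 * pi * x) = 0" "sin (2 * pi * y) = 0"
    have "pi * real (2 * N - b) * z / real N = 2 * pi * z - pi * real b * z / real N"
      using that(1) assms(3) by (simp add: of_nat_diff field_simps)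
    then show ?thesis
      unfolding wave_def using that(2) sin0 by (auto simp: sin_diff)
  qed
  have "cos (2 * pi * x) = cos (2 * pi * y + 2 * pi * (x - y))" by (simp add: algebra_simps)
  also have "\<dots> = cos (2 * pi * y)"
    unfolding cos_add using xy(1) by (simp add: sin_integer_2pi cos_integer_2pi)
  finally have "cos (2 * pi * x) * cos (2 * pi * y) = cos (2 * pi * y) ^ 2"
    by (simp add: power2_eq_square)
  also have "\<dots> = 1"
    using \<open>sin (2 * pi * y) = 0\<close> by (simp add: cos_squared_eq)
  finally have cc: "cos (2 * pi * x) * cos (2 * pi * y) = 1" .
  have refl: "g (2 * N - b) = g b" if "b \<le> 2 * N" for b
  proof -
    have "pi * real (2 * N - b) / (2 * real N) = pi - pi * real b / (2 * real N)"
      using that assms(3) by (simp add: of_nat_diff field_simps)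
    then have "amplitude N (2 * N - b) = - amplitude N b"
      unfolding amplitude_def by simp
    then have "amplitude N (2 * N - b) ^ k = amplitude N b ^ k" using assms(1) by simp
    then have "g (2 * N - b) = g b * (cos (2 * pi * x) * cos (2 * pi * y))"
      unfolding g_def using w[OF that] by simp
    then show ?thesis unfolding cc by simp
  qed
  have parity: "(2 * N - b) mod 2 = b mod 2" if "b \<le> 2 * N" for b
    using that by (simp add: mod_2_eq_odd)
  \<comment> \<open>The two frequencies fixed by the folding modulo \<open>2 * N\<close> drop out:
    at 0 the wave vanishes, at \<open>N\<close> the amplitude does, and its power is 0 because
    \<open>k > 0\<close>.\<close>
  have "g 0 = 0" by (simp add: g_def wave_def)
  have "g N = 0" using assms(2,3) by (simp add: g_def amplitude_def)
  have "(\<Sum>b\<in>freqs N s. g b) = (\<Sum>b\<in>low_freqs N s \<union> {b \<in> freqs N s. N < b}. g b)"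
  proof (rule sum.mono_neutral_right)
    show "\<forall>b\<in>freqs N s - (low_freqs N s \<union> {b \<in> freqs N s. N < b}). g b = 0"
    proof
      fix b assume "b \<in> freqs N s - (low_freqs N s \<union> {b \<in> freqs N s. N < b})"
      then have "b = 0 \<or> b = N" by (auto simp: freqs_def low_freqs_def)
      then show "g b = 0" using \<open>g 0 = 0\<close> \<open>g N = 0\<close> by blast
    qed
  qed (auto simp: freqs_def low_freqs_def)
  also have "\<dots> = (\<Sum>b\<in>low_freqs N s. g b) + (\<Sum>b\<in>{b \<in> freqs N s. N < b}. g b)"
    by (rule sum.union_disjoint) (auto simp: freqs_def low_freqs_def)
  also have "(\<Sum>b\<in>{b \<in> freqs N s. N < b}. g b) = (\<Sum>b\<in>low_freqs N s. g b)"
  proof (rule sum.reindex_bij_witness[of _ "\<lambda>b. 2 * N - b" "\<lambda>b. 2 * N - b"])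
    fix b assume "b \<in> {b \<in> freqs N s. N < b}"
    then have b: "N < b" "b < 2 * N" "b mod 2 = s" by (auto simp: freqs_def)
    then show "2 * N - (2 * N - b) = b" "2 * N - b \<in> low_freqs N s" "g (2 * N - b) = g b"
      using refl[of b] parity[of b] by (simp_all add: low_freqs_def)
  next
    fix b assume "b \<in> low_freqs N s"
    then have b: "0 < b" "b < N" "b mod 2 = s" by (auto simp: low_freqs_def)
    then show "2 * N - (2 * N - b) = b" "2 * N - b \<in> {b \<in> freqs N s. N < b}"
      using parity[of b] by (simp_all add: freqs_def)
  qed
  finally have "(\<Sum>b\<in>freqs N s. g b) = 2 * (\<Sum>b\<in>low_freqs N s. g b)" by simp
  then have "walk_kernel N s k x y = 4 / real N * (\<Sum>b\<in>low_freqs N s. g b)"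
    unfolding walk_kernel_def g_def amplitude_def by simp
  then show ?thesis unfolding g_def sum_distrib_left by (simp add: mult_ac)
qed

section \<open>Expansion over tuples of frequencies\<close>

text \<open>The wave in \<open>y\<close> is constant along row \<open>i\<close>, so it enters as a
  scalar and only a determinant in \<open>\<eta>\<close> is left. A determinant in \<open>y\<close>
  reappears after summing over the rearrangements of \<open>b\<close>.\<close>

definition wave_coeff :: "nat \<Rightarrow> nat \<Rightarrow> (nat \<Rightarrow> real) \<Rightarrow> (nat \<Rightarrow> real) \<Rightarrow> (nat \<Rightarrow> nat) \<Rightarrow> real" where
  "wave_coeff n N y \<eta> b = (\<Prod>i<n. 4 / real N * wave N (b i) (y (Suc i)))
     * fdet n (\<lambda>i j. wave N (b i) (\<eta> (Suc j)))"

lemma wave_coeff_not_inj: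
  assumes "\<not> inj_on b {..<n}"
  shows "wave_coeff n N y \<eta> b = 0"
proof -
  obtain i i' where "i < n" "i' < n" "i \<noteq> i'" "b i = b i'"
    using assms by (auto simp: inj_on_def)
  then have "fdet n (\<lambda>i j. wave N (b i) (\<eta> (Suc j))) = 0"
    by (intro fdet_proportional_rows[of i n i' _ 1]) auto
  then show ?thesis by (simp add: wave_coeff_def)
qed

text \<open>Folding each entry before expanding the rows leaves only tuples of frequencies below
  \<open>N\<close>, whose amplitudes are positive.\<close>

lemma wdet_even:
  assumes "even k" "k > 0" "N > 0" and al: "aligned n 0 y \<eta>"
  shows "wdet n N s k y \<eta> = (\<Sum>b\<in>PiE {..<n} (\<lambda>_. low_freqs N s).
    (\<Prod>i<n. amplitude N (b i)) ^ k * wave_coeff n N y \<eta> b)"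
proof -
  have "wdet n N s k y \<eta> = fdet n (\<lambda>i j. \<Sum>b\<in>low_freqs N s.
      (4 / real N * amplitude N b ^ k * wave N b (y (Suc i))) * wave N b (\<eta> (Suc j)))"
    unfolding wdet_def
  proof (rule fdet_cong)
    fix i j assume "i < n" "j < n"
    then have "y (Suc i) - \<eta> (Suc j) \<in> \<int>" "y (Suc i) + \<eta> (Suc j) \<in> \<int>"
      using al by (auto simp: aligned_def)
    then show "walk_kernel N s k (y (Suc i)) (\<eta> (Suc j)) = (\<Sum>b\<in>low_freqs N s.
        (4 / real N * amplitude N b ^ k * wave N b (y (Suc i))) * wave N b (\<eta> (Suc j)))"
      by (rule walk_kernel_even[OF assms(1-3)])
  qed
  also have "\<dots> = (\<Sum>b\<in>PiE {..<n} (\<lambda>_. low_freqs N s).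
      (\<Prod>i<n. 4 / real N * amplitude N (b i) ^ k * wave N (b i) (y (Suc i)))
      * fdet n (\<lambda>i j. wave N (b i) (\<eta> (Suc j))))"
    by (rule fdet_row_sums) simp
  also have "\<dots> = (\<Sum>b\<in>PiE {..<n} (\<lambda>_. low_freqs N s).
      (\<Prod>i<n. amplitude N (b i)) ^ k * wave_coeff n N y \<eta> b)"
  proof (intro sum.cong refl)
    fix b
    have "(\<Prod>i<n. 4 / real N * amplitude N (b i) ^ k * wave N (b i) (y (Suc i)))
        = (\<Prod>i<n. amplitude N (b i)) ^ k * (\<Prod>i<n. 4 / real N * wave N (b i) (y (Suc i)))"
      unfolding prod_power_distrib prod.distrib[symmetric] by (intro prod.cong) simp_all
    then show "(\<Prod>i<n. 4 / real N * amplitude N (b i) ^ k * wave N (b i) (y (Suc i)))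
        * fdet n (\<lambda>i j. wave N (b i) (\<eta> (Suc j)))
        = (\<Prod>i<n. amplitude N (b i)) ^ k * wave_coeff n N y \<eta> b"
      by (simp only: wave_coeff_def mult.assoc)
  qed
  finally show ?thesis .
qed

section \<open>Strict dominance of the lowest odd frequencies\<close>

text \<open>Induction by removing the largest element \<open>a\<close> of \<open>S\<close>: having
  \<open>Suc n\<close> elements forces \<open>n \<le> a\<close>, so \<open>f a \<le> f n\<close>. If
  \<open>S\<close> is not an initial segment, either \<open>n < a\<close> or the rest of
  \<open>S\<close> gives strictness.\<close>

lemma prod_antimono_le:
  fixes f :: "nat \<Rightarrow> real"
  assumes "\<And>l. l < M \<Longrightarrow> 0 < f l" and dec: "\<And>i j. i < j \<Longrightarrow> j < M \<Longrightarrow> f j < f i"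
    and "S \<subseteq> {..<M}" "card S = n"
  shows "(\<Prod>l\<in>S. f l) \<le> (\<Prod>l<n. f l) \<and> (S \<noteq> {..<n} \<longrightarrow> (\<Prod>l\<in>S. f l) < (\<Prod>l<n. f l))"
  using assms(3,4)
proof (induction n arbitrary: S)
  case 0
  then have "S = {}" using finite_subset[of S "{..<M}"] by auto
  then show ?case by simp
next
  case (Suc n)
  have fin: "finite S" using Suc.prems finite_subset[of S "{..<M}"] by auto
  define a where "a = Max S"
  have "S \<noteq> {}" using Suc.prems(2) by auto
  then have a: "a \<in> S" "\<And>l. l \<in> S \<Longrightarrow> l \<le> a" using fin by (auto simp: a_def)
  have "S \<subseteq> {..a}" using a by auto
  then have "card S \<le> card {..a}" by (intro card_mono) auto
  then have "n \<le> a" using Suc.prems(2) by simp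
  have aM: "a < M" using a Suc.prems by auto
  define S' where "S' = S - {a}"
  have S': "S' \<subseteq> {..<M}" "card S' = n" using Suc.prems a fin by (auto simp: S'_def)
  have prod_S: "(\<Prod>l\<in>S. f l) = (\<Prod>l\<in>S'. f l) * f a"
    unfolding S'_def using prod.remove[OF fin a(1), of f] by simp
  have pos: "0 < (\<Prod>l\<in>S'. f l)" using S' assms(1) by (intro prod_pos) auto
  have pos': "0 < (\<Prod>l<n. f l)" using \<open>n \<le> a\<close> aM assms(1) by (intro prod_pos) auto
  note IH = Suc.IH[OF S']
  show ?case
  proof (cases "a = n")
    case True
    have "S' \<noteq> {..<n}" if "S \<noteq> {..<Suc n}"
      using that a(1) True by (auto simp: S'_def lessThan_Suc)
    then show ?thesis
      unfolding prod_S prod.lessThan_Suc True[symmetric] using IH assms(1)[OF aM] True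
      by (auto intro: mult_right_mono mult_strict_right_mono)
  next
    case False
    then have "f a < f n" using \<open>n \<le> a\<close> aM by (intro dec) auto
    then have "(\<Prod>l\<in>S'. f l) * f a < (\<Prod>l<n. f l) * f n"
      using IH pos pos' assms(1)[OF aM] by (intro mult_le_less_imp_less) auto
    then show ?thesis unfolding prod_S by simp
  qed
qed

lemma amplitude_pos:
  assumes "b < N"
  shows "0 < amplitude N b"
proof -
  have "0 \<le> pi * real b / (2 * real N)" "pi * real b / (2 * real N) < pi / 2"
    using assms by (simp_all add: field_simps)
  then show ?thesis
    unfolding amplitude_def using pi_gt_zero by (intro mult_pos_pos cos_gt_zero_pi) linarith+
qed

lemma amplitude_nonneg:
  assumes "b \<le> N"
  shows "0 \<le> amplitude N b"
proof (cases "b = N")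
  case True
  then show ?thesis by (cases "N = 0") (simp_all add: amplitude_def)
qed (use assms amplitude_pos[of b N] in simp)

lemma amplitude_less:
  assumes "a < b" "b \<le> N"
  shows "amplitude N b < amplitude N a"
  unfolding amplitude_def
  using assms by (intro mult_strict_left_mono cos_monotone_0_pi) (auto simp: field_simps)

text \<open>The index \<open>(b - 1) div 2\<close> counts both parities from 0: 1, 3, 5, ... for
  \<open>s = 1\<close> and 2, 4, 6, ... for \<open>s = 0\<close>.\<close>

lemma low_freqs_eq: "b \<in> low_freqs N s \<Longrightarrow> b = 2 * ((b - 1) div 2) + 2 - s"
  unfolding low_freqs_def by simp presburger

lemma inj_low_freqs: "inj_on (\<lambda>b. (b - 1) div 2) (low_freqs N s)"
proof (rule inj_onI)
  fix a b assume "a \<in> low_freqs N s" "b \<in> low_freqs N s" and eq: "(a - 1) div 2 = (b - 1) div 2"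
  from low_freqs_eq[OF this(1)] low_freqs_eq[OF this(2)] show "a = b" unfolding eq by (rule trans[OF _ sym])
qed

text \<open>Within one parity the product is largest on the first \<open>n\<close> indices. For odd
  frequencies this maximum is the excluded tuple; for even ones it is 2, 4, ..., 2n, which loses to
  1, 3, ..., 2n-1 factor by factor.\<close>

lemma prod_amplitude_less:
  assumes n: "n \<ge> 1" "2 * n \<le> N" and s: "s < 2"
    and b: "b \<in> PiE {..<n} (\<lambda>_. low_freqs N s)" "inj_on b {..<n}"
    and not_lead: "\<not> (s = 1 \<and> b ` {..<n} = (\<lambda>i. 2 * i + 1) ` {..<n})"
  shows "(\<Prod>i<n. amplitude N (b i)) < (\<Prod>i<n. amplitude N (2 * i + 1))"
proof -
  \<comment> \<open>\<open>M\<close> is the number of frequencies of parity \<open>s\<close>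
    strictly between 0 and \<open>N\<close>.\<close>
  define M where "M = (N + s - 1) div 2"
  define h where "h = (\<lambda>b :: nat. (b - 1) div 2)"
  define f where "f l = amplitude N (2 * l + 2 - s)" for l
  have bL: "b i \<in> low_freqs N s" if "i < n" for i using b(1) that by (auto simp: PiE_iff)
  have hb: "b i = 2 * h (b i) + 2 - s" if "i < n" for i
    unfolding h_def by (rule low_freqs_eq[OF bL[OF that]])
  have inj: "inj_on (h \<circ> b) {..<n}"
    using b(2) inj_low_freqs[of N s] bL unfolding h_def
    by (intro comp_inj_on) (auto intro: inj_on_subset)
  define S where "S = (h \<circ> b) ` {..<n}"
  have "card S = n" unfolding S_def using card_image[OF inj] by simp
  have M: "2 * l + 2 - s < N" if "l < M" for l using that s by (auto simp: M_def)
  have "S \<subseteq> {..<M}"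
  proof
    fix l assume "l \<in> S"
    then obtain i where "i < n" "l = h (b i)" by (auto simp: S_def)
    then have "2 * l + 2 - s < N" using bL[of i] hb[of i] by (auto simp: low_freqs_def)
    then show "l \<in> {..<M}" using s by (auto simp: M_def)
  qed
  have "(\<Prod>i<n. amplitude N (b i)) = (\<Prod>i<n. f ((h \<circ> b) i))"
    unfolding f_def using hb by (intro prod.cong) auto
  also have "\<dots> = (\<Prod>l\<in>S. f l)" unfolding S_def by (subst prod.reindex[OF inj]) (simp add: o_def)
  finally have eq: "(\<Prod>i<n. amplitude N (b i)) = (\<Prod>l\<in>S. f l)" .
  have le: "(\<Prod>l\<in>S. f l) \<le> (\<Prod>l<n. f l) \<and> (S \<noteq> {..<n} \<longrightarrow> (\<Prod>l\<in>S. f l) < (\<Prod>l<n. f l))"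
  proof (rule prod_antimono_le)
    fix i j :: nat assume "i < j" "j < M"
    then show "f j < f i" unfolding f_def using M[of j] s by (intro amplitude_less) auto
  next
    fix l assume "l < M"
    then show "0 < f l" unfolding f_def using M[of l] by (intro amplitude_pos)
  qed fact+
  consider "s = 1" | "s = 0" using s by linarith
  then show ?thesis
  proof cases
    case 1
    have "S \<noteq> {..<n}"
    proof
      assume S: "S = {..<n}"
      have "b ` {..<n} = (\<lambda>l. 2 * l + 1) ` S"
        unfolding S_def image_image using hb 1 by (intro image_cong) auto
      then show False using not_lead 1 S by simp
    qed
    then show ?thesis unfolding eq using le by (simp add: f_def 1)
  next
    case 2
    have "(\<Prod>l<n. f l) < (\<Prod>i<n. amplitude N (2 * i + 1))"
    proof (rule prod_mono_strict[of 0])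
      show "f 0 < amplitude N (2 * 0 + 1)"
        unfolding f_def using n 2 by (intro amplitude_less) auto
    next
      show "0 \<le> f i \<and> f i \<le> amplitude N (2 * i + 1)" if "i \<in> {..<n}" for i
        using amplitude_less[of "2 * i + 1" "2 * i + 2" N] amplitude_nonneg[of "2 * i + 2" N] that n 2
        by (simp add: f_def)
    next
      show "0 < amplitude N (2 * i + 1)" if "i \<in> {..<n}" for i
        using that n by (intro amplitude_pos) auto
    qed (use n in auto)
    then show ?thesis unfolding eq using le by simp
  qed
qed

text \<open>The tuples are \<open>2 * p i + 1\<close> for permutations \<open>p\<close>. Reordering
  the rows of the determinant in \<open>\<eta>\<close> produces \<open>sign p\<close>, which turns
  the sum of the products of waves in \<open>y\<close> into a second determinant.\<close>

lemma sum_wave_coeff_leading: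
  assumes "2 * n \<le> N"
  shows "(\<Sum>b\<in>{b \<in> PiE {..<n} (\<lambda>_. low_freqs N 1). b ` {..<n} = (\<lambda>i. 2 * i + 1) ` {..<n}}.
      wave_coeff n N y \<eta> b)
    = (4 / real N) ^ n * fdet n (\<lambda>i j. wave N (2 * i + 1) (y (Suc j)))
      * fdet n (\<lambda>i j. wave N (2 * i + 1) (\<eta> (Suc j)))"
proof -
  let ?D = "fdet n (\<lambda>i j. wave N (2 * i + 1) (\<eta> (Suc j)))"
  let ?O = "(\<lambda>i :: nat. 2 * i + 1) ` {..<n}"
  let ?B = "{b \<in> PiE {..<n} (\<lambda>_. low_freqs N 1). b ` {..<n} = ?O}"
  have "(\<Sum>b\<in>?B. wave_coeff n N y \<eta> b)
      = (\<Sum>p | p permutes {..<n}. wave_coeff n N y \<eta> (\<lambda>i. if i < n then 2 * p i + 1 else undefined))"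
  proof (rule sum.reindex_bij_witness[of _ "\<lambda>p i. if i < n then 2 * p i + 1 else undefined"
        "\<lambda>b i. if i < n then b i div 2 else i"])
    fix b assume b: "b \<in> ?B"
    have odd_b: "2 * (b i div 2) + 1 = b i" if "i < n" for i
    proof -
      have "b i mod 2 = 1" using b that by (auto simp: PiE_iff low_freqs_def)
      then show ?thesis by presburger
    qed
    show *: "(\<lambda>i. if i < n then 2 * (if i < n then b i div 2 else i) + 1 else undefined) = b"
      using b odd_b by (auto simp: fun_eq_iff PiE_iff extensional_def)
    have "(\<lambda>i. if i < n then b i div 2 else i) ` {..<n} = (\<lambda>c. c div 2) ` b ` {..<n}"
      by (auto simp: image_iff)
    also have "\<dots> = (\<lambda>c. c div 2) ` ?O" using b by simp
    also have "\<dots> = {..<n}" unfolding image_image by simp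
    finally have img: "(\<lambda>i. if i < n then b i div 2 else i) ` {..<n} = {..<n}" .
    \<comment> \<open>A map of a finite set onto itself is injective, which makes the halved tuple a
      permutation.\<close>
    then have "inj_on (\<lambda>i. if i < n then b i div 2 else i) {..<n}"
      by (intro eq_card_imp_inj_on) auto
    then have "bij_betw (\<lambda>i. if i < n then b i div 2 else i) {..<n} {..<n}"
      using img by (simp add: bij_betw_def)
    then show "(\<lambda>i. if i < n then b i div 2 else i) \<in> {p. p permutes {..<n}}"
      by (intro CollectI bij_imp_permutes) simp_all
    show "wave_coeff n N y \<eta> (\<lambda>i. if i < n then 2 * (if i < n then b i div 2 else i) + 1 else undefined)
        = wave_coeff n N y \<eta> b"
      unfolding * ..
  next
    fix p assume "p \<in> {p. p permutes {..<n}}"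
    then have p: "p permutes {..<n}" by simp
    have pn: "p i < n \<longleftrightarrow> i < n" for i using permutes_in_image[OF p, of i] by simp
    have bound: "Suc (2 * p i) < N" if "i < n" for i using pn[of i] that assms by linarith
    show "(\<lambda>i. if i < n then (if i < n then 2 * p i + 1 else undefined) div 2 else i) = p"
      using permutes_not_in[OF p] by (auto simp: fun_eq_iff)
    have "(\<lambda>i. if i < n then 2 * p i + 1 else undefined) ` {..<n} = (\<lambda>i. 2 * i + 1) ` p ` {..<n}"
      by (auto simp: image_iff)
    also have "\<dots> = ?O" using permutes_image[OF p] by simp
    finally show "(\<lambda>i. if i < n then 2 * p i + 1 else undefined) \<in> ?B"
      using bound by (auto simp: PiE_iff extensional_def low_freqs_def)
  qed
  also have "\<dots> = (\<Sum>p | p permutes {..<n}. ((4 / real N) ^ n * ?D)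
      * (of_int (sign p) * (\<Prod>i<n. wave N (2 * p i + 1) (y (Suc i)))))"
  proof (rule sum.cong)
    fix p assume "p \<in> {p. p permutes {..<n}}"
    then have p: "p permutes {..<n}" by simp
    have "wave_coeff n N y \<eta> (\<lambda>i. if i < n then 2 * p i + 1 else undefined)
        = (\<Prod>i<n. 4 / real N * wave N (2 * p i + 1) (y (Suc i)))
          * fdet n (\<lambda>i j. wave N (2 * p i + 1) (\<eta> (Suc j)))"
      unfolding wave_coeff_def by (intro arg_cong2[of _ _ _ _ "(*)"] prod.cong fdet_cong) auto
    also have "fdet n (\<lambda>i j. wave N (2 * p i + 1) (\<eta> (Suc j))) = of_int (sign p) * ?D"
      by (rule fdet_permute_rows[OF p])
    finally show "wave_coeff n N y \<eta> (\<lambda>i. if i < n then 2 * p i + 1 else undefined)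
        = ((4 / real N) ^ n * ?D) * (of_int (sign p) * (\<Prod>i<n. wave N (2 * p i + 1) (y (Suc i))))"
      by (simp only: prod.distrib prod_constant card_lessThan mult_ac)
  qed simp
  also have "\<dots> = ((4 / real N) ^ n * ?D) * fdet n (\<lambda>i j. wave N (2 * j + 1) (y (Suc i)))"
    unfolding fdet_expand[of n "\<lambda>i j. wave N (2 * j + 1) (y (Suc i))"] sum_distrib_left ..
  also have "fdet n (\<lambda>i j. wave N (2 * j + 1) (y (Suc i)))
      = fdet n (\<lambda>i j. wave N (2 * i + 1) (y (Suc j)))"
    by (rule fdet_transpose)
  finally show ?thesis by simp
qed

text \<open>Termwise limits in a finite sum: tuples with a repetition vanish, rearrangements of 1,
  3, ..., 2n-1 have ratio 1 to \<open>\<Lambda>\<close>, and all others have a nonnegative ratio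
  below 1.\<close>

lemma tendsto_wave_sum:
  assumes n: "n \<ge> 1" "2 * n \<le> N" and s: "s < 2"
  defines "\<Lambda> \<equiv> \<Prod>i<n. amplitude N (2 * i + 1)"
  shows "(\<lambda>k. (\<Sum>b\<in>PiE {..<n} (\<lambda>_. low_freqs N s).
      (\<Prod>i<n. amplitude N (b i)) ^ k * wave_coeff n N y \<eta> b) / \<Lambda> ^ k)
    \<longlonglongrightarrow> (if s = 1 then (4 / real N) ^ n * fdet n (\<lambda>i j. wave N (2 * i + 1) (y (Suc j)))
      * fdet n (\<lambda>i j. wave N (2 * i + 1) (\<eta> (Suc j))) else 0)"
proof -
  let ?P = "PiE {..<n} (\<lambda>_. low_freqs N s)"
  let ?lead = "\<lambda>b. s = 1 \<and> b ` {..<n} = (\<lambda>i. 2 * i + 1) ` {..<n}"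
  have \<Lambda>: "\<Lambda> > 0" unfolding \<Lambda>_def using n by (intro prod_pos) (auto intro: amplitude_pos)
  have "(\<lambda>k. (\<Prod>i<n. amplitude N (b i)) ^ k * wave_coeff n N y \<eta> b / \<Lambda> ^ k)
      \<longlonglongrightarrow> (if ?lead b then wave_coeff n N y \<eta> b else 0)" if b: "b \<in> ?P" for b
  proof (cases "inj_on b {..<n}")
    case False
    then show ?thesis by (simp add: wave_coeff_not_inj)
  next
    case inj: True
    have eq: "(\<lambda>k. (\<Prod>i<n. amplitude N (b i)) ^ k * wave_coeff n N y \<eta> b / \<Lambda> ^ k)
        = (\<lambda>k. ((\<Prod>i<n. amplitude N (b i)) / \<Lambda>) ^ k * wave_coeff n N y \<eta> b)"
      by (simp add: power_divide)
    show ?thesis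
    proof (cases "?lead b")
      case True
      have "(\<Prod>i<n. amplitude N (b i)) = (\<Prod>c\<in>b ` {..<n}. amplitude N c)"
        using inj by (simp add: prod.reindex)
      also have "\<dots> = \<Lambda>"
        unfolding conjunct2[OF True] \<Lambda>_def by (subst prod.reindex) (auto intro: inj_onI)
      finally show ?thesis unfolding eq using True \<Lambda> by simp
    next
      case False
      have "0 \<le> (\<Prod>i<n. amplitude N (b i))"
        using b by (intro prod_nonneg) (auto simp: PiE_iff low_freqs_def intro!: less_imp_le amplitude_pos)
      moreover have "(\<Prod>i<n. amplitude N (b i)) < \<Lambda>"
        unfolding \<Lambda>_def by (rule prod_amplitude_less[OF n s b inj False])
      ultimately have "(\<lambda>k. ((\<Prod>i<n. amplitude N (b i)) / \<Lambda>) ^ k) \<longlonglongrightarrow> 0"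
        using \<Lambda> by (intro LIMSEQ_realpow_zero) auto
      from tendsto_mult_left_zero[OF this, of "wave_coeff n N y \<eta> b"]
      show ?thesis unfolding eq if_not_P[OF False] .
    qed
  qed
  then have "(\<lambda>k. \<Sum>b\<in>?P. (\<Prod>i<n. amplitude N (b i)) ^ k * wave_coeff n N y \<eta> b / \<Lambda> ^ k)
      \<longlonglongrightarrow> (\<Sum>b\<in>?P. if ?lead b then wave_coeff n N y \<eta> b else 0)"
    by (intro tendsto_sum)
  also have "(\<Sum>b\<in>?P. if ?lead b then wave_coeff n N y \<eta> b else 0)
      = (\<Sum>b\<in>{b \<in> ?P. ?lead b}. wave_coeff n N y \<eta> b)"
    by (rule sum.inter_filter[symmetric]) (intro finite_PiE, auto)
  also have "\<dots> = (if s = 1 then (4 / real N) ^ n * fdet n (\<lambda>i j. wave N (2 * i + 1) (y (Suc j)))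
      * fdet n (\<lambda>i j. wave N (2 * i + 1) (\<eta> (Suc j))) else 0)"
    using sum_wave_coeff_leading[OF n(2), of y \<eta>] by (cases "s = 1") simp_all
  finally show ?thesis by (simp add: sum_divide_distrib)
qed

section \<open>Closed form of the limit\<close>

lemma prod_triangle:
  fixes n :: nat
  shows "(\<Prod>i<n. \<Prod>l<i. g l i) = (\<Prod>h\<in>{1..n}. \<Prod>t\<in>{h<..n}. g (h - 1) (t - 1) :: real)"
proof -
  have "(\<Prod>i<n. \<Prod>l<i. g l i) = (\<Prod>(i, l)\<in>(SIGMA i:{..<n}. {..<i}). g l i)"
    by (subst prod.Sigma) auto
  also have "\<dots> = (\<Prod>(h, t)\<in>(SIGMA h:{1..n}. {h<..n}). g (h - 1) (t - 1))"
    by (rule prod.reindex_bij_witness[of _ "\<lambda>(h, t). (t - 1, h - 1)" "\<lambda>(i, l). (Suc l, Suc i)"]) auto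
  also have "\<dots> = (\<Prod>h\<in>{1..n}. \<Prod>t\<in>{h<..n}. g (h - 1) (t - 1))"
    by (subst prod.Sigma) auto
  finally show ?thesis .
qed

text \<open>Signs cancel in the square, and the exponents add up to 2(0 + 1 + ... + (n-1)) + n =
  n^2.\<close>

lemma prod_minus_four_squared: "(\<Prod>i<n. (-4) ^ i) * (\<Prod>i<n. (-4) ^ i) * 4 ^ n = (4 ^ (n\<^sup>2) :: real)"
proof (induction n)
  case (Suc n)
  have "(\<Prod>i<Suc n. (-4) ^ i) * (\<Prod>i<Suc n. (-4) ^ i) * (4 ^ Suc n :: real)
      = ((\<Prod>i<n. (-4) ^ i) * (\<Prod>i<n. (-4) ^ i) * 4 ^ n) * (((-4) ^ n * (-4) ^ n) * 4)"
    by (simp add: mult_ac)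
  also have "(-4) ^ n * (-4) ^ n = (4 ^ (2 * n) :: real)"
    by (simp only: mult_2 power_add power_mult_distrib[symmetric]) simp
  also note Suc
  also have "4 ^ n\<^sup>2 * (4 ^ (2 * n) * 4) = (4 ^ (Suc n)\<^sup>2 :: real)"
    by (simp add: power2_eq_square power_add mult_2)
  finally show ?case .
qed simp

lemma fdet_wave_mult:
  "fdet n (\<lambda>i j. wave N (2 * i + 1) (y (Suc j))) * fdet n (\<lambda>i j. wave N (2 * i + 1) (\<eta> (Suc j))) * 4 ^ n
    = 4 ^ (n\<^sup>2)
      * (\<Prod>h\<in>{1..n}. \<Prod>t\<in>{h<..n}.
           sin (pi * (\<eta> h - \<eta> t) / real N) * sin (pi * (y h - y t) / real N)
           * sin (pi * (\<eta> h + \<eta> t) / real N) * sin (pi * (y h + y t) / real N))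
      * (\<Prod>h=1..n. sin (pi * \<eta> h / real N) * sin (pi * y h / real N))"
proof -
  define \<theta> where "\<theta> x i = pi * x (Suc i) / real N" for x :: "nat \<Rightarrow> real" and i
  define p where "p x = (\<Prod>i<n. sin (\<theta> x i))" for x
  define v where "v x = (\<Prod>i<n. \<Prod>l<i. sin (\<theta> x i - \<theta> x l) * sin (\<theta> x i + \<theta> x l))" for x
  let ?c = "\<Prod>i<n. (-4) ^ i :: real"
  have det: "fdet n (\<lambda>i j. wave N (2 * i + 1) (x (Suc j))) = p x * ?c * v x" for x
  proof -
    have "fdet n (\<lambda>i j. wave N (2 * i + 1) (x (Suc j)))
        = fdet n (\<lambda>i j. sin (real (2 * i + 1) * \<theta> x j))"
      unfolding wave_def \<theta>_def by (intro fdet_cong arg_cong[of _ _ sin]) simp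
    then show ?thesis unfolding fdet_sin p_def v_def .
  qed
  have "v \<eta> * v y = (\<Prod>i<n. \<Prod>l<i. sin (pi * (\<eta> (Suc l) - \<eta> (Suc i)) / real N)
      * sin (pi * (y (Suc l) - y (Suc i)) / real N)
      * sin (pi * (\<eta> (Suc l) + \<eta> (Suc i)) / real N) * sin (pi * (y (Suc l) + y (Suc i)) / real N))"
    unfolding v_def prod.distrib[symmetric]
  proof (intro prod.cong refl)
    fix i l
    \<comment> \<open>The determinants subtract the earlier coordinate from the later one, the
      formula does the opposite. The sign change occurs once for \<open>\<eta>\<close> and once for
      \<open>y\<close>, so it cancels.\<close>
    have "sin (\<theta> x i - \<theta> x l) = - sin (pi * (x (Suc l) - x (Suc i)) / real N)"
      "sin (\<theta> x i + \<theta> x l) = sin (pi * (x (Suc l) + x (Suc i)) / real N)" for x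
      unfolding \<theta>_def sin_minus[symmetric]
      by (rule arg_cong[of _ _ sin], simp add: algebra_simps add_divide_distrib diff_divide_distrib)+
    then show "sin (\<theta> \<eta> i - \<theta> \<eta> l) * sin (\<theta> \<eta> i + \<theta> \<eta> l) * (sin (\<theta> y i - \<theta> y l) * sin (\<theta> y i + \<theta> y l))
        = sin (pi * (\<eta> (Suc l) - \<eta> (Suc i)) / real N) * sin (pi * (y (Suc l) - y (Suc i)) / real N)
          * sin (pi * (\<eta> (Suc l) + \<eta> (Suc i)) / real N) * sin (pi * (y (Suc l) + y (Suc i)) / real N)"
      by (simp only:) (simp add: mult_ac)
  qed
  also have "\<dots> = (\<Prod>h\<in>{1..n}. \<Prod>t\<in>{h<..n}.
           sin (pi * (\<eta> h - \<eta> t) / real N) * sin (pi * (y h - y t) / real N)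
           * sin (pi * (\<eta> h + \<eta> t) / real N) * sin (pi * (y h + y t) / real N))"
    unfolding prod_triangle[of "\<lambda>l i. sin (pi * (\<eta> (Suc l) - \<eta> (Suc i)) / real N)
      * sin (pi * (y (Suc l) - y (Suc i)) / real N)
      * sin (pi * (\<eta> (Suc l) + \<eta> (Suc i)) / real N) * sin (pi * (y (Suc l) + y (Suc i)) / real N)"]
    by (intro prod.cong refl) simp
  finally have v: "v \<eta> * v y = \<dots>" .
  have p: "p \<eta> * p y = (\<Prod>h=1..n. sin (pi * \<eta> h / real N) * sin (pi * y h / real N))"
    unfolding p_def \<theta>_def prod.distrib[symmetric] by (simp add: prod.atLeast1_atMost_eq)
  have "fdet n (\<lambda>i j. wave N (2 * i + 1) (y (Suc j))) * fdet n (\<lambda>i j. wave N (2 * i + 1) (\<eta> (Suc j))) * 4 ^ n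
      = (?c * ?c * 4 ^ n) * (v \<eta> * v y) * (p \<eta> * p y)"
    unfolding det by (simp only: mult_ac)
  then show ?thesis unfolding v p prod_minus_four_squared .
qed

section \<open>Lattice conditions and the final asymptotics\<close>

lemma two_times_half_integral:
  assumes "m > 0" "m \<in> \<int> \<or> half_integer m"
  obtains N :: nat where "real N = 2 * m" "N > 0"
proof -
  have "2 * m \<in> \<int>"
    using assms(2) by (auto simp: half_integer_def mult.commute)
  then obtain a :: int where a: "2 * m = of_int a" by (auto elim: Ints_cases)
  then have "a > 0" using assms(1) by linarith
  then show ?thesis using a by (intro that[of "nat a"]) simp_all
qed

lemma aligned_0:
  assumes "(\<forall>j\<in>{1..n}. \<eta> j \<in> \<int> \<and> \<mu> j \<in> \<int>) \<or> (\<forall>j\<in>{1..n}. half_integer (\<eta> j) \<and> half_integer (\<mu> j))"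
  shows "aligned n 0 \<mu> \<eta>"
  unfolding aligned_def
proof (intro ballI)
  fix i j assume ij: "i \<in> {1..n}" "j \<in> {1..n}"
  have "\<mu> i - \<eta> j \<in> \<int> \<and> \<mu> i + \<eta> j \<in> \<int>"
    using assms
  proof
    assume "\<forall>j\<in>{1..n}. \<eta> j \<in> \<int> \<and> \<mu> j \<in> \<int>"
    then show ?thesis using ij by auto
  next
    assume "\<forall>j\<in>{1..n}. half_integer (\<eta> j) \<and> half_integer (\<mu> j)"
    then have "half_integer (\<mu> i)" "half_integer (\<eta> j)" using ij by auto
    then obtain a b :: int where "odd a" "\<mu> i = of_int a / 2" "odd b" "\<eta> j = of_int b / 2"
      by (auto simp: half_integer_def)
    moreover from this obtain c d where "a = 2 * c + 1" "b = 2 * d + 1" by (auto elim!: oddE)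
    ultimately have "\<mu> i - \<eta> j = of_int (c - d)" "\<mu> i + \<eta> j = of_int (c + d + 1)"
      by (simp_all add: field_simps)
    then show ?thesis by (simp only: Ints_of_int)
  qed
  then show "\<mu> i - \<eta> j - real 0 / 2 \<in> \<int> \<and> \<mu> i + \<eta> j - real 0 / 2 \<in> \<int>" by simp
qed

lemma aligned_even:
  assumes "aligned n 0 y \<eta>" "even k"
  shows "aligned n k y \<eta>"
proof -
  obtain l where "k = 2 * l" using assms(2) by (elim evenE)
  then have "real k / 2 \<in> \<int>" by simp
  then show ?thesis using assms(1) unfolding aligned_def by simp
qed

text \<open>From the bottom up, the coordinates are at least 1/2, 3/2, 5/2, ..., so for
  \<open>n \<ge> 2\<close> the first two add up to at least 2n-2, which must stay below
  \<open>N\<close>.\<close>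

lemma alcove_size:
  assumes n: "n \<ge> 1" and N: "real N = 2 * m" "N > 0"
    and x: "x \<in> alcove_B n m" "aligned n k x \<eta>"
  shows "2 * n \<le> N + 1"
proof -
  have low: "real l + 1/2 \<le> x (n - l)" if "l < n" for l
    using that
  proof (induction l)
    case 0
    have "0 < x n + x n" "x n + x n \<in> \<int>"
      using alcove_pos[OF n N x(1), of n] aligned_diff_sum(2)[OF x(2), of n n] n by auto
    then have "0 + 1 \<le> x n + x n" by (intro Ints_less_imp_add_one_le) auto
    then show ?case by simp
  next
    case (Suc l)
    have "0 < x (n - Suc l) - x (n - l)" "x (n - Suc l) - x (n - l) \<in> \<int>"
      using alcove_less[OF n N x(1), of "n - Suc l" "n - l"]
        aligned_diff_sum(1)[OF x(2), of "n - Suc l" "n - l"] Suc.prems by auto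
    then have "0 + 1 \<le> x (n - Suc l) - x (n - l)" by (intro Ints_less_imp_add_one_le) auto
    then show ?case using Suc by simp
  qed
  show ?thesis
  proof (cases "n \<ge> 2")
    case True
    have "n - (n - 1) = 1" "n - (n - 2) = 2" using True by auto
    then have "real (n - 1) + 1/2 \<le> x 1" "real (n - 2) + 1/2 \<le> x 2"
      using low[of "n - 1"] low[of "n - 2"] True by auto
    moreover have "x 1 + x 2 < real N" using alcove_add_less[OF n N x(1), of 1 2] True by simp
    ultimately have "real (n - 1) + real (n - 2) + 1 < real N" by linarith
    then have "real (n - 1 + (n - 2) + 1) < real N" by simp
    then have "n - 1 + (n - 2) + 1 < N" by (simp only: of_nat_less_iff)
    then show ?thesis using True by linarith
  next
    case False
    then show ?thesis using n N by simp
  qed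
qed

text \<open>Pigeonhole: each parity has at most \<open>n - 1\<close> frequencies strictly between 0
  and \<open>N\<close>, so every tuple repeats one.\<close>

lemma wdet_eq_0_if_small:
  assumes "N < 2 * n" "even k" "k > 0" "N > 0" "aligned n 0 y \<eta>"
  shows "wdet n N s k y \<eta> = 0"
  unfolding wdet_even[OF assms(2-5)]
proof (rule sum.neutral, rule ballI)
  fix b assume b: "b \<in> PiE {..<n} (\<lambda>_. low_freqs N s)"
  have "card ((\<lambda>b. (b - 1) div 2) ` low_freqs N s) \<le> card {..<n - 1}"
    using assms(1) by (intro card_mono) (auto simp: low_freqs_def)
  then have "card (low_freqs N s) \<le> n - 1" using card_image[OF inj_low_freqs[of N s]] by simp
  moreover have "b ` {..<n} \<subseteq> low_freqs N s" using b by (auto simp: PiE_iff)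
  then have "card (b ` {..<n}) \<le> card (low_freqs N s)" by (intro card_mono) auto
  ultimately have "card (b ` {..<n}) \<noteq> n" using assms(1,4) by linarith
  then have "\<not> inj_on b {..<n}" using card_image[of b "{..<n}"] by auto
  then show "(\<Prod>i<n. amplitude N (b i)) ^ k * wave_coeff n N y \<eta> b = 0"
    by (simp add: wave_coeff_not_inj)
qed

text \<open>Here \<open>\<mu> j + \<eta> j\<close> is an integer, so its double is an even number
  congruent to \<open>k\<close>.\<close>

lemma rcong_imp_even:
  assumes "aligned n 0 \<mu> \<eta>" "j \<in> {1..n}" "[real k = 2 * \<eta> j + 2 * \<mu> j] (rmod 2)"
  shows "even k"
proof -
  have "\<mu> j + \<eta> j \<in> \<int>" using assms(1,2) by (auto simp: aligned_def)
  then obtain a :: int where "\<mu> j + \<eta> j = of_int a" by (auto elim: Ints_cases)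
  moreover obtain c where "2 * \<eta> j + 2 * \<mu> j = real k + of_int c * 2"
    using assms(3) by (auto simp: rcong_altdef)
  ultimately have "real_of_int (int k) = of_int (2 * (a - c))" by simp
  then have "int k = 2 * (a - c)" by (simp only: of_int_eq_iff)
  then show ?thesis by presburger
qed

theorem theorem27:
  fixes n :: nat and m :: real and \<eta> \<mu> :: "nat \<Rightarrow> real"
  assumes "n \<ge> 1"
    and "m > 0" and "m \<in> \<int> \<or> half_integer m"
    and "\<eta> \<in> alcove_B n m" and "\<mu> \<in> alcove_B n m"
    and "(\<forall>j\<in>{1..n}. \<eta> j \<in> \<int> \<and> \<mu> j \<in> \<int>) \<or>
         (\<forall>j\<in>{1..n}. half_integer (\<eta> j) \<and> half_integer (\<mu> j))"
  shows "(\<lambda>k. real (card (diagonal_walks n (alcove_B n m) \<eta> \<mu> k)))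
    \<sim>[inf sequentially (principal {k. \<forall>j\<in>{1..n}. [real k = 2 * \<eta> j + 2 * \<mu> j] (rmod 2)})]
    (\<lambda>k. 4 ^ (n\<^sup>2) / (2 * (2 * m) ^ n)
      * (2 ^ n * (\<Prod>j=1..n. cos ((2 * real j - 1) * pi / (4 * m)))) ^ k
      * (\<Prod>h\<in>{1..n}. \<Prod>t\<in>{h<..n}.
           sin (pi * (\<eta> h - \<eta> t) / (2 * m)) * sin (pi * (\<mu> h - \<mu> t) / (2 * m))
           * sin (pi * (\<eta> h + \<eta> t) / (2 * m)) * sin (pi * (\<mu> h + \<mu> t) / (2 * m)))
      * (\<Prod>h=1..n. sin (pi * \<eta> h / (2 * m)) * sin (pi * \<mu> h / (2 * m))))"
proof -
  obtain N where N: "real N = 2 * m" "N > 0"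
    using two_times_half_integral[OF assms(2,3)] .
  have al: "aligned n 0 \<mu> \<eta>" using aligned_0[OF assms(6)] .
  define F where "F = inf sequentially
    (principal {k. \<forall>j\<in>{1..n}. [real k = 2 * \<eta> j + 2 * \<mu> j] (rmod 2)})"
  define w where "w k = real (card (diagonal_walks n (alcove_B n m) \<eta> \<mu> k))" for k
  define \<Lambda> where "\<Lambda> = (\<Prod>i<n. amplitude N (2 * i + 1))"
  define C where "C = 4 ^ (n\<^sup>2) / (2 * (2 * m) ^ n)
      * (\<Prod>h\<in>{1..n}. \<Prod>t\<in>{h<..n}.
           sin (pi * (\<eta> h - \<eta> t) / (2 * m)) * sin (pi * (\<mu> h - \<mu> t) / (2 * m))
           * sin (pi * (\<eta> h + \<eta> t) / (2 * m)) * sin (pi * (\<mu> h + \<mu> t) / (2 * m)))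
      * (\<Prod>h=1..n. sin (pi * \<eta> h / (2 * m)) * sin (pi * \<mu> h / (2 * m)))"
  have \<Lambda>_eq: "\<Lambda> = 2 ^ n * (\<Prod>j=1..n. cos ((2 * real j - 1) * pi / (4 * m)))"
  proof -
    have "\<Lambda> = (\<Prod>i<n. 2 * cos ((2 * real (Suc i) - 1) * pi / (4 * m)))"
      unfolding \<Lambda>_def amplitude_def N(1) by (intro prod.cong refl) (simp add: algebra_simps)
    then show ?thesis by (simp add: prod.distrib prod.atLeast1_atMost_eq)
  qed
  have ev: "\<forall>\<^sub>F k in F. even k \<and> k > 0"
    unfolding F_def eventually_inf_principal
    using eventually_gt_at_top[of 0]
    by eventually_elim (use rcong_imp_even[OF al, of 1] assms(1) in auto)
  have w_even: "w k = (wdet n N 0 k \<mu> \<eta> + wdet n N 1 k \<mu> \<eta>) / 2" if "even k" for k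
    unfolding w_def using card_diagonal_walks_eq[OF assms(1) N assms(4,5) aligned_even[OF al that]] .
  have "w \<sim>[F] (\<lambda>k. C * \<Lambda> ^ k)"
  proof (cases "2 * n \<le> N")
    case False
    have "2 * n = N + 1" using alcove_size[OF assms(1) N assms(5) al] False by simp
    then have "2 * (n - 1) + 1 = N" using assms(1) by simp
    \<comment> \<open>The last leading frequency is exactly \<open>N\<close>, with amplitude 2
      cos(pi/2) = 0. Both sides are then eventually 0, and eventual equality suffices for
      \<open>asymp_equiv\<close>.\<close>
    then have "amplitude N (2 * (n - 1) + 1) = 0" using N(2) by (simp add: amplitude_def)
    then have "\<Lambda> = 0" unfolding \<Lambda>_def using assms(1) by (intro prod_zero bexI[of _ "n - 1"]) auto
    have "\<forall>\<^sub>F k in F. w k = C * \<Lambda> ^ k"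
      using ev by eventually_elim
        (use False N(2) al \<open>\<Lambda> = 0\<close> in \<open>auto simp: w_even wdet_eq_0_if_small\<close>)
    then show ?thesis by (rule asymp_equiv_refl_ev)
  next
    case True
    have pos: "\<Lambda> > 0" unfolding \<Lambda>_def using True by (intro prod_pos) (auto intro: amplitude_pos)
    let ?P = "\<lambda>s. PiE {..<n} (\<lambda>_. low_freqs N s)"
    define G where "G s k = (\<Sum>b\<in>?P s. (\<Prod>i<n. amplitude N (b i)) ^ k * wave_coeff n N \<mu> \<eta> b)" for s k
    let ?D = "fdet n (\<lambda>i j. wave N (2 * i + 1) (\<mu> (Suc j))) * fdet n (\<lambda>i j. wave N (2 * i + 1) (\<eta> (Suc j)))"
    have "(\<lambda>k. G 0 k / \<Lambda> ^ k) \<longlonglongrightarrow> 0" "(\<lambda>k. G 1 k / \<Lambda> ^ k) \<longlonglongrightarrow> (4 / real N) ^ n * ?D"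
      using tendsto_wave_sum[OF assms(1) True, of 0 \<mu> \<eta>] tendsto_wave_sum[OF assms(1) True, of 1 \<mu> \<eta>]
      unfolding G_def \<Lambda>_def by (simp_all add: mult.assoc)
    \<comment> \<open>Even frequencies contribute nothing in the limit, so the mean halves the odd
      contribution; this is the 2 in the denominator of \<open>C\<close>.\<close>
    then have "(\<lambda>k. (G 0 k / \<Lambda> ^ k + G 1 k / \<Lambda> ^ k) / 2) \<longlonglongrightarrow> (0 + (4 / real N) ^ n * ?D) / 2"
      by (intro tendsto_intros) auto
    also have "(0 + (4 / real N) ^ n * ?D) / 2 = ?D * 4 ^ n / (2 * real N ^ n)"
      by (simp add: power_divide mult.commute)
    also have "\<dots> = C"
      unfolding fdet_wave_mult C_def N(1) by simp
    \<comment> \<open>The spectral sums converge along all \<open>k\<close>, but they count walks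
      only at positive even times; hence the restriction to \<open>F\<close>.\<close>
    finally have "((\<lambda>k. (G 0 k / \<Lambda> ^ k + G 1 k / \<Lambda> ^ k) / 2) \<longlongrightarrow> C) F"
      unfolding F_def by (rule tendsto_mono[OF inf_le1])
    moreover have "\<forall>\<^sub>F k in F. (G 0 k / \<Lambda> ^ k + G 1 k / \<Lambda> ^ k) / 2 = w k / \<Lambda> ^ k"
      using ev
    proof eventually_elim
      case (elim k)
      then have "w k = (G 0 k + G 1 k) / 2"
        using w_even[of k] wdet_even[OF _ _ N(2) al, of k] unfolding G_def by simp
      then show ?case by (simp add: add_divide_distrib)
    qed
    ultimately have lim: "((\<lambda>k. w k / \<Lambda> ^ k) \<longlongrightarrow> C) F"
      by (rule Lim_transform_eventually)
    have sin_pos: "sin (pi * a / (2 * m)) > 0" if "0 < a" "a < real N" for a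
      using that N assms(2) by (intro sin_gt_zero) (simp_all add: field_simps)
    \<comment> \<open>A nonzero limit of \<open>w k / \<Lambda> ^ k\<close> is what turns
      convergence into asymptotic equivalence. In the alcove all angles lie strictly between 0 and
      pi.\<close>
    have "C > 0"
      unfolding C_def
    proof (intro mult_pos_pos prod_pos ballI)
      show "0 < 4 ^ n\<^sup>2 / (2 * (2 * m) ^ n)" using assms(2) by simp
    next
      fix h t assume ht: "h \<in> {1..n}" "t \<in> {h<..n}"
      have *: "0 < x h - x t" "x h - x t < real N" "0 < x h + x t" "x h + x t < real N"
        if x: "x \<in> alcove_B n m" for x
        using alcove_less[OF assms(1) N x, of h t] alcove_add_less[OF assms(1) N x, of h t]
          alcove_pos[OF assms(1) N x, of h] alcove_pos[OF assms(1) N x, of t] ht by auto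
      show "0 < sin (pi * (\<eta> h - \<eta> t) / (2 * m))" "0 < sin (pi * (\<mu> h - \<mu> t) / (2 * m))"
        "0 < sin (pi * (\<eta> h + \<eta> t) / (2 * m))" "0 < sin (pi * (\<mu> h + \<mu> t) / (2 * m))"
        using *[OF assms(4)] *[OF assms(5)] by (auto intro: sin_pos)
    next
      fix h assume h: "h \<in> {1..n}"
      show "0 < sin (pi * \<eta> h / (2 * m))" "0 < sin (pi * \<mu> h / (2 * m))"
        using alcove_pos[OF assms(1) N] alcove_less_N[OF assms(1) N] assms(4,5) h
        by (auto intro: sin_pos)
    qed
    then show ?thesis using lim by (intro asymp_equivI'_const) auto
  qed
  then show ?thesis
    unfolding w_def F_def C_def \<Lambda>_eq by (simp only: mult_ac)
qed

end
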